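(* Let $N \geq 2$ be an integer and $\alpha_* = 2(N-1)+1$. Then: (a) if $2(N-1) < \alpha < \alpha_*$, the set $SF^N(\mathbb{T})$ is nowhere dense in $A^2_\alpha$; (b) if $\alpha = \alpha_*$, the set $SF^N(\mathbb{T})$ is not dense in $A^2_\alpha$; (c) if $\alpha > \alpha_* + 1$, the set $SF^N(\mathbb{T})$ is dense in $A^2_\alpha$.
   Context: $\mathbb{D}$ is the open unit disc, $\mathbb{T}$ the unit circle. For $\alpha > -1$, $A^2_\alpha$ is the weighted Bergman space of holomorphic functions $f$ on $\mathbb{D}$ with $\|f\|_\alpha^2 = (\alpha+1)\int_{\mathbb{D}} |f(z)|^2 (1-|z|^2)^\alpha \, dA(z) < \infty$, where $dA$ is Lebesgue area measure normalized so that $\mathbb{D}$ has measure $1$. $SF^N(\mathbb{T})$ is the set of all functions $z \mapsto \sum_{0 \leq k < n} \frac{1}{(z-a_k)^N}$ with $n \in \mathbb{N}$ and $a_0,\ldots,a_{n-1} \in \mathbb{T}$ (repetitions allowed); it is contained in $A^2_\alpha$ when $\alpha > 2(N-1)$. *)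

theory Defs
  imports "HOL-Complex_Analysis.Complex_Analysis"
begin

definition area_measure :: "complex measure" where
  "area_measure = uniform_measure lborel (ball 0 1)"

definition bergman_norm :: "real \<Rightarrow> (complex \<Rightarrow> complex) \<Rightarrow> real" where
  "bergman_norm \<alpha> f =
     sqrt ((\<alpha> + 1) *
       (LINT z:ball 0 1|area_measure. (cmod (f z))\<^sup>2 * (1 - (cmod z)\<^sup>2) powr \<alpha>))"

text \<open>
  Functions on the disc are represented by total functions that are \<open>undefined\<close> outside the
  disc, so that equality in HOL is equality of functions on the disc.
\<close>

definition bergman_space :: "real \<Rightarrow> (complex \<Rightarrow> complex) set" where
  "bergman_space \<alpha> =
     {f. f \<in> extensional (ball 0 1) \<and> f holomorphic_on ball 0 1 \<and>
         set_integrable area_measure (ball 0 1)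
           (\<lambda>z. (cmod (f z))\<^sup>2 * (1 - (cmod z)\<^sup>2) powr \<alpha>)}"

definition bergman_dist ::
    "real \<Rightarrow> (complex \<Rightarrow> complex) \<Rightarrow> (complex \<Rightarrow> complex) \<Rightarrow> real" where
  "bergman_dist \<alpha> f g = bergman_norm \<alpha> (\<lambda>z. f z - g z)"

definition bergman_topology :: "real \<Rightarrow> (complex \<Rightarrow> complex) topology" where
  "bergman_topology \<alpha> = Metric_space.mtopology (bergman_space \<alpha>) (bergman_dist \<alpha>)"

text \<open>
  The poles \<open>a k\<close> need not be distinct; \<open>n = 0\<close> gives the zero function.
\<close>

definition SF :: "nat \<Rightarrow> (complex \<Rightarrow> complex) set" where
  "SF N =
     {restrict (\<lambda>z. \<Sum>k<n. 1 / (z - a k) ^ N) (ball 0 1) | (n :: nat) (a :: nat \<Rightarrow> complex).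
        \<forall>k<n. a k \<in> sphere 0 1}"

text \<open>
  For \<open>\<alpha> > -1\<close> the distance is a metric on the Bergman space, so \<open>bergman_topology\<close> is
  the norm topology.
\<close>

lemma weighted_measurable:
  assumes "f holomorphic_on ball 0 1"
  shows "set_borel_measurable area_measure (ball 0 1)
           (\<lambda>z. (cmod (f z))\<^sup>2 * (1 - (cmod z)\<^sup>2) powr \<alpha>)"
proof -
  have "1 - (cmod z)\<^sup>2 \<noteq> 0" if "z \<in> ball 0 1" for z
    using that abs_square_less_1[of "cmod z"] by simp
  then have "continuous_on (ball 0 1) (\<lambda>z. (cmod (f z))\<^sup>2 * (1 - (cmod z)\<^sup>2) powr \<alpha>)"
    using holomorphic_on_imp_continuous_on[OF assms]
    by (intro continuous_intros) auto
  then have "set_borel_measurable borel (ball 0 1)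
           (\<lambda>z. (cmod (f z))\<^sup>2 * (1 - (cmod z)\<^sup>2) powr \<alpha>)"
    unfolding set_borel_measurable_def
    by (intro borel_measurable_continuous_on_indicator) auto
  then show ?thesis
    unfolding set_borel_measurable_def area_measure_def
    by (simp cong: measurable_cong_sets)
qed

lemma weighted_integrable_add:
  assumes hol: "f holomorphic_on ball 0 1" "g holomorphic_on ball 0 1"
    and f: "set_integrable area_measure (ball 0 1)
              (\<lambda>z. (cmod (f z))\<^sup>2 * (1 - (cmod z)\<^sup>2) powr \<alpha>)"
    and g: "set_integrable area_measure (ball 0 1)
              (\<lambda>z. (cmod (g z))\<^sup>2 * (1 - (cmod z)\<^sup>2) powr \<alpha>)"
    and \<alpha>: "\<alpha> > -1"
  shows "set_integrable area_measure (ball 0 1)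
           (\<lambda>z. (cmod (f z + g z))\<^sup>2 * (1 - (cmod z)\<^sup>2) powr \<alpha>)" (is ?int)
    and "bergman_norm \<alpha> (\<lambda>z. f z + g z) \<le> bergman_norm \<alpha> f + bergman_norm \<alpha> g" (is ?tri)
proof -
  define W where "W h z = (cmod (h z))\<^sup>2 * (1 - (cmod z)\<^sup>2) powr \<alpha>"
    for h :: "complex \<Rightarrow> complex" and z
  define J where "J h = (LINT z:ball 0 1|area_measure. W h z)" for h
  have J0: "J h \<ge> 0" for h
    unfolding J_def W_def set_lebesgue_integral_def by (intro Bochner_Integration.integral_nonneg) auto
  have pw: "W (\<lambda>z. f z + g z) z \<le> (1 + t) * W f z + (1 + 1 / t) * W g z" if "t > 0" for t z
  proof -
    have "(cmod (f z + g z))\<^sup>2 \<le> (cmod (f z) + cmod (g z))\<^sup>2"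
      by (intro power_mono norm_triangle_ineq) auto
    also have "\<dots> \<le> (1 + t) * (cmod (f z))\<^sup>2 + (1 + 1 / t) * (cmod (g z))\<^sup>2"
    proof -
      have "0 \<le> (t * cmod (f z) - cmod (g z))\<^sup>2 / t"
        using that by simp
      also have "\<dots> = (1 + t) * (cmod (f z))\<^sup>2 + (1 + 1 / t) * (cmod (g z))\<^sup>2
                      - (cmod (f z) + cmod (g z))\<^sup>2"
        using that by (simp add: field_simps power2_eq_square)
      finally show ?thesis by simp
    qed
    finally have "W (\<lambda>z. f z + g z) z
        \<le> ((1 + t) * (cmod (f z))\<^sup>2 + (1 + 1 / t) * (cmod (g z))\<^sup>2) * (1 - (cmod z)\<^sup>2) powr \<alpha>"
      unfolding W_def by (intro mult_right_mono) auto
    then show ?thesis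
      by (simp add: W_def algebra_simps)
  qed
  have fi: "set_integrable area_measure (ball 0 1) (W f)"
    and gi: "set_integrable area_measure (ball 0 1) (W g)"
    using f g by (simp_all add: W_def[abs_def])
  have si: "set_integrable area_measure (ball 0 1) (\<lambda>z. (1 + t) * W f z + (1 + 1 / t) * W g z)"
    for t
    by (intro set_integral_add set_integrable_mult_right fi gi)
  have i: "set_integrable area_measure (ball 0 1) (W (\<lambda>z. f z + g z))"
  proof (rule set_integrable_bound[OF si[of 1]])
    show "set_borel_measurable area_measure (ball 0 1) (W (\<lambda>z. f z + g z))"
      using weighted_measurable[of "\<lambda>z. f z + g z" \<alpha>] hol
      by (simp add: W_def[abs_def] holomorphic_on_add)
    show "AE z in area_measure. z \<in> ball 0 1 \<longrightarrow>
            norm (W (\<lambda>z. f z + g z) z) \<le> norm ((1 + 1) * W f z + (1 + 1 / 1) * W g z)"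
    proof (intro AE_I2 impI)
      fix z
      have "W (\<lambda>z. f z + g z) z \<ge> 0" by (simp add: W_def)
      then show "norm (W (\<lambda>z. f z + g z) z) \<le> norm ((1 + 1) * W f z + (1 + 1 / 1) * W g z)"
        using pw[of 1 z] by simp
    qed
  qed
  then show ?int by (simp add: W_def[abs_def])
  have Jt: "J (\<lambda>z. f z + g z) \<le> (1 + t) * J f + (1 + 1 / t) * J g" if "t > 0" for t
  proof -
    have "J (\<lambda>z. f z + g z)
        \<le> (LINT z:ball 0 1|area_measure. (1 + t) * W f z + (1 + 1 / t) * W g z)"
      unfolding J_def by (intro set_integral_mono i si pw that)
    also have "\<dots> = (1 + t) * J f + (1 + 1 / t) * J g"
      unfolding J_def using fi gi by (subst set_integral_add) auto
    finally show ?thesis .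
  qed
  have main: "sqrt (J (\<lambda>z. f z + g z)) \<le> sqrt (J f) + sqrt (J g)"
  proof (rule field_le_epsilon)
    fix e :: real assume "e > 0"
    define a where "a = sqrt (J f) + e / 2"
    define b where "b = sqrt (J g) + e / 2"
    have ab: "a > 0" "b > 0"
      using \<open>e > 0\<close> J0 by (auto simp: a_def b_def intro: add_nonneg_pos)
    have "J f \<le> a\<^sup>2" "J g \<le> b\<^sup>2"
      using \<open>e > 0\<close> J0 by (auto simp: a_def b_def intro!: sqrt_le_D)
    have "J (\<lambda>z. f z + g z) \<le> (1 + b / a) * J f + (1 + 1 / (b / a)) * J g"
      using ab by (intro Jt) auto
    also have "\<dots> \<le> (1 + b / a) * a\<^sup>2 + (1 + 1 / (b / a)) * b\<^sup>2"
      using ab \<open>J f \<le> a\<^sup>2\<close> \<open>J g \<le> b\<^sup>2\<close> by (intro add_mono mult_left_mono) auto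
    also have "\<dots> = (a + b)\<^sup>2"
      using ab by (simp add: field_simps power2_eq_square)
    finally have "sqrt (J (\<lambda>z. f z + g z)) \<le> a + b"
      using ab by (intro real_le_lsqrt) auto
    then show "sqrt (J (\<lambda>z. f z + g z)) \<le> sqrt (J f) + sqrt (J g) + e"
      by (simp add: a_def b_def)
  qed
  have n: "bergman_norm \<alpha> h = sqrt (\<alpha> + 1) * sqrt (J h)" for h
    by (simp add: bergman_norm_def J_def W_def real_sqrt_mult)
  show ?tri
    unfolding n using \<alpha> main
    by (simp flip: distrib_left)
qed

lemma weighted_norm_eq_0:
  assumes hol: "f holomorphic_on ball 0 1"
    and f: "set_integrable area_measure (ball 0 1)
              (\<lambda>z. (cmod (f z))\<^sup>2 * (1 - (cmod z)\<^sup>2) powr \<alpha>)"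
    and \<alpha>: "\<alpha> > -1" and 0: "bergman_norm \<alpha> f = 0" and z: "z \<in> ball 0 1"
  shows "f z = 0"
proof -
  have "(LINT z:ball 0 1|area_measure. (cmod (f z))\<^sup>2 * (1 - (cmod z)\<^sup>2) powr \<alpha>) = 0"
    using 0 \<alpha> by (simp add: bergman_norm_def)
  then have "AE z in area_measure.
      indicator (ball 0 1) z *\<^sub>R ((cmod (f z))\<^sup>2 * (1 - (cmod z)\<^sup>2) powr \<alpha>) = 0"
    using f unfolding set_integrable_def set_lebesgue_integral_def
    by (subst (asm) integral_nonneg_eq_0_iff_AE) auto
  then have "AE z in lborel. z \<in> ball 0 1 \<longrightarrow>
      indicator (ball 0 1) z *\<^sub>R ((cmod (f z))\<^sup>2 * (1 - (cmod z)\<^sup>2) powr \<alpha>) = 0"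
    unfolding area_measure_def
    by (subst (asm) AE_uniform_measure)
      (auto simp: emeasure_lborel_ball_finite emeasure_ball unit_ball_vol_2 less_top)
  then have ae: "AE z in lborel. z \<in> ball 0 1 \<longrightarrow> f z = 0"
  proof eventually_elim
    case (elim z)
    have "1 - (cmod z)\<^sup>2 \<noteq> 0" if "z \<in> ball 0 1"
      using that abs_square_less_1[of "cmod z"] by simp
    then show ?case using elim by auto
  qed
  define U where "U = {z \<in> ball 0 1. f z \<noteq> 0}"
  have "open U"
    using continuous_open_preimage[OF holomorphic_on_imp_continuous_on[OF hol], of "- {0}"]
    by (auto simp: U_def vimage_def Int_def)
  have "AE z in lebesgue. z \<notin> U"
    using ae by (intro AE_completion) (auto simp: U_def elim: eventually_mono)
  then have "negligible U"
    using \<open>open U\<close> by (simp add: negligible_iff_null_sets AE_iff_null_sets)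
  then have "U = {}"
    using \<open>open U\<close> open_not_negligible by blast
  then show ?thesis using z by (auto simp: U_def)
qed

lemma Metric_space_bergman:
  assumes \<alpha>: "\<alpha> > -1"
  shows "Metric_space (bergman_space \<alpha>) (bergman_dist \<alpha>)"
proof
  have neg: "bergman_norm \<alpha> (\<lambda>z. - f z) = bergman_norm \<alpha> f" for f
    by (simp add: bergman_norm_def)
  have diff: "(\<lambda>z. f z - g z) holomorphic_on ball 0 1"
      "set_integrable area_measure (ball 0 1)
         (\<lambda>z. (cmod (f z - g z))\<^sup>2 * (1 - (cmod z)\<^sup>2) powr \<alpha>)"
    if "f \<in> bergman_space \<alpha>" "g \<in> bergman_space \<alpha>" for f g
    using that weighted_integrable_add(1)[of f "\<lambda>z. - g z" \<alpha>] \<alpha>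
    by (auto simp: bergman_space_def intro!: holomorphic_on_diff holomorphic_on_minus)
  show "0 \<le> bergman_dist \<alpha> f g" for f g
    unfolding bergman_dist_def bergman_norm_def set_lebesgue_integral_def
    using \<alpha> by (intro real_sqrt_ge_zero mult_nonneg_nonneg Bochner_Integration.integral_nonneg) auto
  show "bergman_dist \<alpha> f g = bergman_dist \<alpha> g f" for f g
    using neg[of "\<lambda>z. f z - g z"] by (simp add: bergman_dist_def)
  show "bergman_dist \<alpha> f g = 0 \<longleftrightarrow> f = g"
    if fg: "f \<in> bergman_space \<alpha>" "g \<in> bergman_space \<alpha>" for f g
  proof
    assume "bergman_dist \<alpha> f g = 0"
    then have "f z - g z = 0" if "z \<in> ball 0 1" for z
      using weighted_norm_eq_0[OF diff[OF fg] \<alpha> _ that] by (simp add: bergman_dist_def)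
    then show "f = g"
      using fg by (intro extensionalityI[of _ "ball 0 1"]) (auto simp: bergman_space_def)
  qed (simp add: bergman_dist_def bergman_norm_def)
  show "bergman_dist \<alpha> f h \<le> bergman_dist \<alpha> f g + bergman_dist \<alpha> g h"
    if "f \<in> bergman_space \<alpha>" "g \<in> bergman_space \<alpha>" "h \<in> bergman_space \<alpha>" for f g h
    using weighted_integrable_add(2)[OF diff(1)[of f g] diff(1)[of g h] diff(2) diff(2) \<alpha>] that
    by (simp add: bergman_dist_def)
qed

end

theory Submission
  imports Defs "HOL-Real_Asymp.Real_Asymp" "HOL-Probability.Characteristic_Functions"
begin

text \<open>
  In terms of the power sums \<open>p\<^sub>j = \<Sum>\<^sub>k cnj (a\<^sub>k) ^ j\<close> the \<open>m\<close>-th Taylor coefficient of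
  \<open>\<Sum>\<^sub>k 1 / (z - a\<^sub>k) ^ N\<close> is \<open>\<plusminus> ((m + N - 1) choose (N - 1)) * p\<^sub>m\<^sub>+\<^sub>N\<close>, so its squared norm is
  comparable to \<open>\<Sum> \<bar>p\<^sub>j\<bar>\<^sup>2 j powr (-1 - \<beta>)\<close>, summed over \<open>j \<ge> N\<close>, with \<open>\<beta> = \<alpha> - 2 * (N - 1)\<close>.

  A Fejer type positivity argument shows that the \<open>\<bar>p\<^sub>j\<bar>\<^sup>2\<close> with \<open>N \<le> j < 4 * N * n\<close> sum up to at
  least \<open>N * n\<^sup>2\<close>, hence the squared norm is at least \<open>c * n powr (1 - \<beta>)\<close>. For \<open>\<beta> = 1\<close> this
  isolates the zero function. For \<open>\<beta> < 1\<close> it bounds the number of poles of the members of \<open>SF N\<close>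
  in a ball, hence the Taylor coefficients of all their limits, and a small multiple of \<open>z ^ m\<close>
  with \<open>m\<close> large violates such a bound.

  For \<open>\<beta> > 2\<close> take the poles \<open>cis (\<tau> + u \<tau> / n)\<close>, where \<open>\<tau>\<close> runs through the \<open>n\<close>-th roots of unity
  and \<open>u\<close> is a real trigonometric polynomial with Fourier coefficients \<open>b\<^sub>j / 2\<close>. Then
  \<open>p\<^sub>j \<longlonglongrightarrow> - \<i> * j * b\<^sub>j / 2\<close> for every \<open>j \<ge> 1\<close> and \<open>\<bar>p\<^sub>j\<bar> \<le> C * j\<close> uniformly in \<open>n\<close>, so dominated
  convergence gives convergence in norm to an arbitrary polynomial.
\<close>

section \<open>Rotation invariance of the area measure\<close>

text \<open>Lebesgue measure is determined by its values on boxes, and a complex box is a product of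
  two intervals. This makes Fubini available on the complex plane.\<close>

lemma lborel_complex_eq: "(lborel :: complex measure) = distr (lborel \<Otimes>\<^sub>M lborel) borel (\<lambda>(x, y). Complex x y)"
proof (rule lborel_eqI)
  fix l u :: complex
  assume le: "\<And>b. b \<in> Basis \<Longrightarrow> l \<bullet> b \<le> u \<bullet> b"
  have m [measurable]: "(\<lambda>(x, y). Complex x y) \<in> borel_measurable (lborel \<Otimes>\<^sub>M lborel)"
    unfolding Complex_eq by measurable
  have "(\<lambda>(x, y). Complex x y) -` box l u \<inter> space (lborel \<Otimes>\<^sub>M lborel)
      = {Re l<..<Re u} \<times> {Im l<..<Im u}"
    by (auto simp: in_box_complex_iff space_pair_measure)
  then have "emeasure (distr (lborel \<Otimes>\<^sub>M lborel) borel (\<lambda>(x, y). Complex x y)) (box l u)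
      = emeasure (lborel \<Otimes>\<^sub>M lborel) ({Re l<..<Re u} \<times> {Im l<..<Im u})"
    by (subst emeasure_distr) auto
  also have "\<dots> = ennreal (Re u - Re l) * ennreal (Im u - Im l)"
    using le[of 1] le[of \<i>] by (subst lborel.emeasure_pair_measure_Times) (auto simp: Basis_complex_def)
  also have "\<dots> = (\<Prod>b\<in>Basis. (u - l) \<bullet> b)"
    using le[of 1] le[of \<i>] by (simp add: Basis_complex_def ennreal_mult)
  finally show "emeasure (distr (lborel \<Otimes>\<^sub>M lborel) borel (\<lambda>(x, y). Complex x y)) (box l u)
      = (\<Prod>b\<in>Basis. (u - l) \<bullet> b)" .
qed simp

lemma nn_integral_lborel_complex:
  fixes F :: "complex \<Rightarrow> ennreal"
  assumes [measurable]: "F \<in> borel_measurable borel"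
  shows "(\<integral>\<^sup>+z. F z \<partial>lborel) = (\<integral>\<^sup>+x. \<integral>\<^sup>+y. F (Complex x y) \<partial>lborel \<partial>lborel)"
    and "(\<integral>\<^sup>+z. F z \<partial>lborel) = (\<integral>\<^sup>+y. \<integral>\<^sup>+x. F (Complex x y) \<partial>lborel \<partial>lborel)"
proof -
  have [measurable]: "(\<lambda>(x, y). Complex x y) \<in> borel_measurable (lborel \<Otimes>\<^sub>M lborel)"
    unfolding Complex_eq by measurable
  show 1: "(\<integral>\<^sup>+z. F z \<partial>lborel) = (\<integral>\<^sup>+x. \<integral>\<^sup>+y. F (Complex x y) \<partial>lborel \<partial>lborel)"
    by (subst lborel_complex_eq) (simp add: nn_integral_distr lborel.nn_integral_fst[symmetric])
  show "(\<integral>\<^sup>+z. F z \<partial>lborel) = (\<integral>\<^sup>+y. \<integral>\<^sup>+x. F (Complex x y) \<partial>lborel \<partial>lborel)"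
    unfolding 1 by (rule lborel_pair.Fubini'[symmetric]) (simp add: Complex_eq)
qed

lemma nn_integral_lborel_translate_real:
  fixes G :: "real \<Rightarrow> ennreal"
  assumes "G \<in> borel_measurable borel"
  shows "(\<integral>\<^sup>+x. G (x + t) \<partial>lborel) = (\<integral>\<^sup>+x. G x \<partial>lborel)"
  using nn_integral_real_affine[OF assms, of 1 t] by (simp add: add.commute)

text \<open>A shear translates every line parallel to one axis by an amount that is constant on that
  line. Integrating along these lines first, in the matching order of Fubini, reduces the claim to
  translation invariance on the reals.\<close>

lemma nn_integral_lborel_shear:
  fixes F :: "complex \<Rightarrow> ennreal"
  assumes [measurable]: "F \<in> borel_measurable borel"
  shows "(\<integral>\<^sup>+z. F (z + of_real (t * Im z)) \<partial>lborel) = (\<integral>\<^sup>+z. F z \<partial>lborel)"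
    and "(\<integral>\<^sup>+z. F (z + \<i> * of_real (t * Re z)) \<partial>lborel) = (\<integral>\<^sup>+z. F z \<partial>lborel)"
proof -
  have 1: "(\<integral>\<^sup>+x. F (Complex x y + of_real (t * y)) \<partial>lborel) = (\<integral>\<^sup>+x. F (Complex x y) \<partial>lborel)" for y
    using nn_integral_lborel_translate_real[of "\<lambda>x. F (Complex x y)" "t * y"]
    by (simp add: Complex_eq algebra_simps)
  show "(\<integral>\<^sup>+z. F (z + of_real (t * Im z)) \<partial>lborel) = (\<integral>\<^sup>+z. F z \<partial>lborel)"
    by (subst (1 2) nn_integral_lborel_complex(2)) (simp_all add: 1 del: of_real_mult)
  have 2: "(\<integral>\<^sup>+y. F (Complex x y + \<i> * of_real (t * x)) \<partial>lborel) = (\<integral>\<^sup>+y. F (Complex x y) \<partial>lborel)" for x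
    using nn_integral_lborel_translate_real[of "\<lambda>y. F (Complex x y)" "t * x"]
    by (simp add: Complex_eq algebra_simps)
  show "(\<integral>\<^sup>+z. F (z + \<i> * of_real (t * Re z)) \<partial>lborel) = (\<integral>\<^sup>+z. F z \<partial>lborel)"
    by (subst (1 2) nn_integral_lborel_complex(1)) (simp_all add: 2 del: of_real_mult)
qed

text \<open>A rotation by an angle \<open>\<theta> \<noteq> \<pi>\<close> is a product of three shears with parameters
  \<open>- tan (\<theta> / 2)\<close>, \<open>sin \<theta>\<close>, \<open>- tan (\<theta> / 2)\<close>; the rotation by \<open>\<pi>\<close> is the square of the one
  by \<open>\<pi> / 2\<close>.\<close>

lemma nn_integral_lborel_rotate:
  fixes F :: "complex \<Rightarrow> ennreal"
  assumes F: "F \<in> borel_measurable borel" and w: "cmod w = 1"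
  shows "(\<integral>\<^sup>+z. F (w * z) \<partial>lborel) = (\<integral>\<^sup>+z. F z \<partial>lborel)"
proof -
  have main: "(\<integral>\<^sup>+z. F (w * z) \<partial>lborel) = (\<integral>\<^sup>+z. F z \<partial>lborel)"
    if [measurable]: "F \<in> borel_measurable borel" and w: "cmod w = 1" and ne: "w \<noteq> -1" for F :: "complex \<Rightarrow> ennreal" and w
  proof -
    have sq: "(Re w)\<^sup>2 + (Im w)\<^sup>2 = 1"
      using w by (simp add: cmod_def)
    have pos: "1 + Re w \<noteq> 0"
    proof
      assume "1 + Re w = 0"
      then have "Re w = -1" by simp
      with sq have "Im w = 0" by simp
      with \<open>Re w = -1\<close> ne show False by (simp add: complex_eq_iff)
    qed
    define t where "t = - Im w / (1 + Re w)"
    define A where "A z = z + of_real (t * Im z)" for z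
    define B where "B z = z + \<i> * of_real (Im w * Re z)" for z
    have [measurable]: "A \<in> borel_measurable borel" "B \<in> borel_measurable borel"
      unfolding A_def[abs_def] B_def[abs_def] by measurable
    \<comment> \<open>In the matrix product of the three shears the diagonal entries are
      \<open>1 + t * Im w\<close> and the upper right entry is
      \<open>t + (1 + t * Im w) * t\<close>. They have to match \<open>Re w\<close> and
      \<open>- Im w\<close>.\<close>
    have t1: "1 + t * Im w = Re w"
      using pos sq by (simp add: t_def field_simps power2_eq_square)
    have t2: "t * (1 + Re w) = - Im w"
      using pos by (simp add: t_def)
    have t3: "t + (1 + t * Im w) * t = - Im w"
      using t2 unfolding t1 by (simp add: algebra_simps)
    have rot: "w * z = A (B (A z))" for z
    proof (rule complex_eqI)
      have "Re (A (B (A z))) = (1 + t * Im w) * Re z + (t + (1 + t * Im w) * t) * Im z"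
        by (simp add: A_def B_def algebra_simps)
      then show "Re (w * z) = Re (A (B (A z)))"
        unfolding t3 unfolding t1 by simp
      have "Im (A (B (A z))) = Im w * Re z + (1 + t * Im w) * Im z"
        by (simp add: A_def B_def algebra_simps)
      then show "Im (w * z) = Im (A (B (A z)))"
        unfolding t1 by simp
    qed
    have A: "(\<integral>\<^sup>+z. G (A z) \<partial>lborel) = (\<integral>\<^sup>+z. G z \<partial>lborel)"
      if "G \<in> borel_measurable borel" for G :: "complex \<Rightarrow> ennreal"
      using nn_integral_lborel_shear(1)[OF that] by (simp add: A_def)
    have B: "(\<integral>\<^sup>+z. G (B z) \<partial>lborel) = (\<integral>\<^sup>+z. G z \<partial>lborel)"
      if "G \<in> borel_measurable borel" for G :: "complex \<Rightarrow> ennreal"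
      using nn_integral_lborel_shear(2)[OF that] by (simp add: B_def)
    have "(\<integral>\<^sup>+z. F (A (B (A z))) \<partial>lborel) = (\<integral>\<^sup>+z. F (A (B z)) \<partial>lborel)"
      by (rule A) measurable
    also have "\<dots> = (\<integral>\<^sup>+z. F (A z) \<partial>lborel)"
      by (rule B) measurable
    also have "\<dots> = (\<integral>\<^sup>+z. F z \<partial>lborel)"
      by (rule A) measurable
    finally show ?thesis unfolding rot .
  qed
  show ?thesis
  proof (cases "w = -1")
    case True
    have "(\<integral>\<^sup>+z. F (w * z) \<partial>lborel) = (\<integral>\<^sup>+z. F (\<i> * (\<i> * z)) \<partial>lborel)"
      using True by (simp flip: mult.assoc)
    also have "\<dots> = (\<integral>\<^sup>+z. F (\<i> * z) \<partial>lborel)"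
      by (rule main[of "\<lambda>z. F (\<i> * z)"]) (use F in \<open>auto simp: complex_eq_iff\<close>)
    also have "\<dots> = (\<integral>\<^sup>+z. F z \<partial>lborel)"
      by (rule main) (use F in \<open>auto simp: complex_eq_iff\<close>)
    finally show ?thesis .
  qed (use main F w in auto)
qed

lemma nn_integral_area_measure:
  fixes F :: "complex \<Rightarrow> ennreal"
  assumes [measurable]: "F \<in> borel_measurable borel"
  shows "(\<integral>\<^sup>+z. F z \<partial>area_measure) = (\<integral>\<^sup>+z. F z * indicator (ball 0 1) z \<partial>lborel) / ennreal pi"
  unfolding area_measure_def
  by (subst nn_integral_uniform_measure)
     (auto simp: emeasure_ball unit_ball_vol_2)

lemma sets_area_measure [measurable_cong, simp]: "sets area_measure = sets borel"
  by (simp add: area_measure_def)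

lemma nn_integral_area_measure_rotate:
  fixes F :: "complex \<Rightarrow> ennreal"
  assumes [measurable]: "F \<in> borel_measurable borel" and w: "cmod w = 1"
  shows "(\<integral>\<^sup>+z. F (w * z) \<partial>area_measure) = (\<integral>\<^sup>+z. F z \<partial>area_measure)"
proof -
  have ind: "indicator (ball 0 1) (w * z) = (indicator (ball 0 1) z :: ennreal)" for z
    using w by (simp add: indicator_def norm_mult)
  have "(\<integral>\<^sup>+z. F (w * z) * indicator (ball 0 1) (w * z) \<partial>lborel) = (\<integral>\<^sup>+z. F z * indicator (ball 0 1) z \<partial>lborel)"
    by (rule nn_integral_lborel_rotate[OF _ w]) (intro borel_measurable_times_ennreal borel_measurable_indicator assms, simp)
  then show ?thesis
    by (simp add: nn_integral_area_measure ind)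
qed

section \<open>Moments of the weight\<close>

lemma emeasure_area_measure_annulus:
  assumes "0 \<le> x" "x < 1"
  shows "emeasure area_measure {z. x < (cmod z)\<^sup>2} = ennreal (1 - x)"
proof -
  have B: "emeasure lborel (ball 0 1 :: complex set) = ennreal pi"
    by (simp add: emeasure_ball unit_ball_vol_2)
  have C: "emeasure lborel (cball 0 (sqrt x) :: complex set) = ennreal (pi * x)"
    using assms by (simp add: emeasure_cball unit_ball_vol_2)
  have iff: "x < (cmod z)\<^sup>2 \<longleftrightarrow> sqrt x < cmod z" for z
    using real_sqrt_less_iff[of x "(cmod z)\<^sup>2"] by simp
  have "ball 0 1 \<inter> {z. x < (cmod z)\<^sup>2} = ball 0 1 - cball 0 (sqrt x)"
    unfolding iff by auto
  moreover have "cball 0 (sqrt x) \<subseteq> (ball 0 1 :: complex set)"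
    using assms by (intro subsetI) (simp add: le_less_trans[of _ "sqrt x"])
  ultimately have "emeasure lborel (ball 0 1 \<inter> {z. x < (cmod z)\<^sup>2}) = ennreal pi - ennreal (pi * x)"
    using C by (simp add: emeasure_Diff B)
  also have "\<dots> = ennreal (pi * (1 - x))"
    using assms by (simp add: ennreal_minus algebra_simps)
  finally show ?thesis
    using assms unfolding area_measure_def
    by (subst emeasure_uniform_measure) (auto simp: B divide_ennreal)
qed

lemma emeasure_area_measure_UNIV: "emeasure area_measure UNIV = 1"
  unfolding area_measure_def
  by (subst emeasure_uniform_measure) (auto simp: emeasure_ball unit_ball_vol_2 ennreal_divide_self)

text \<open>The annulus formula says that the squared modulus of a random point of the disc is
  uniform on the unit interval. This replaces polar coordinates for radial integrands.\<close>

lemma distr_area_measure_square: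
  "distr area_measure borel (\<lambda>z. (cmod z)\<^sup>2) = uniform_measure lborel {0..1::real}"
proof (rule measure_eqI_lessThan)
  fix x :: real
  have sp: "space area_measure = UNIV"
    by (simp add: area_measure_def)
  have L: "emeasure (distr area_measure borel (\<lambda>z. (cmod z)\<^sup>2)) {x<..}
      = emeasure area_measure {z. x < (cmod z)\<^sup>2}"
    by (subst emeasure_distr) (auto simp: sp intro!: arg_cong2[where f = emeasure])
  have le: "emeasure area_measure A \<le> 1" for A
    using emeasure_space[of area_measure A] by (simp add: sp emeasure_area_measure_UNIV)
  show "emeasure (distr area_measure borel (\<lambda>z. (cmod z)\<^sup>2)) {x<..} < \<infinity>"
    unfolding L using le[of "{z. x < (cmod z)\<^sup>2}"] by (simp add: le_less_trans)
  have R: "emeasure (uniform_measure lborel {0..1}) {x<..} = emeasure lborel ({0..1} \<inter> {x<..})"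
    by (subst emeasure_uniform_measure) (auto simp: divide_ennreal_def)
  consider "x < 0" | "0 \<le> x" "x < 1" | "1 \<le> x" by linarith
  then show "emeasure (distr area_measure borel (\<lambda>z. (cmod z)\<^sup>2)) {x<..}
      = emeasure (uniform_measure lborel {0..1}) {x<..}"
  proof cases
    case 1
    then have "{z. x < (cmod z)\<^sup>2} = UNIV" "{0..1} \<inter> {x<..} = {0..1}"
      by (auto intro: less_le_trans[OF _ zero_le_power2])
    then show ?thesis unfolding L R by (simp add: emeasure_area_measure_UNIV)
  next
    case 2
    then have "{0..1} \<inter> {x<..} = {x<..1}" by auto
    then show ?thesis unfolding L R using 2 by (simp add: emeasure_area_measure_annulus)
  next
    case 3
    have "\<not> x < (cmod z)\<^sup>2" if "cmod z < 1" for z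
      using 3 power_mono[of "cmod z" 1 2] that by simp
    then have "ball 0 1 \<inter> {z. x < (cmod z)\<^sup>2} = {}"
      by auto
    then have "emeasure area_measure {z. x < (cmod z)\<^sup>2} = 0"
      unfolding area_measure_def by (subst emeasure_uniform_measure) auto
    moreover have "{0..1} \<inter> {x<..} = {}" using 3 by auto
    ultimately show ?thesis unfolding L R by simp
  qed
qed auto

lemma nn_integral_area_measure_square:
  fixes g :: "real \<Rightarrow> ennreal"
  assumes [measurable]: "g \<in> borel_measurable borel"
  shows "(\<integral>\<^sup>+z. g ((cmod z)\<^sup>2) \<partial>area_measure) = (\<integral>\<^sup>+t. g t * indicator {0..1} t \<partial>lborel)"
proof -
  have "(\<integral>\<^sup>+z. g ((cmod z)\<^sup>2) \<partial>area_measure) = (\<integral>\<^sup>+t. g t \<partial>uniform_measure lborel {0..1})"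
    by (subst distr_area_measure_square[symmetric], subst nn_integral_distr) auto
  then show ?thesis
    by (simp add: nn_integral_uniform_measure divide_ennreal_def)
qed

text \<open>With t the squared modulus, the moment becomes Euler's Beta integral.\<close>

lemma Beta_eq_nn_integral_area_measure:
  fixes \<alpha> :: real
  assumes "\<alpha> > -1"
  shows "(\<integral>\<^sup>+z. ennreal ((cmod z) ^ (2 * m) * (1 - (cmod z)\<^sup>2) powr \<alpha>) \<partial>area_measure)
    = ennreal (Beta (real m + 1) (\<alpha> + 1))"
proof -
  have "(\<integral>\<^sup>+z. ennreal (((cmod z)\<^sup>2) ^ m * (1 - (cmod z)\<^sup>2) powr \<alpha>) \<partial>area_measure)
      = (\<integral>\<^sup>+t. ennreal (t ^ m * (1 - t) powr \<alpha>) * indicator {0..1} t \<partial>lborel)"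
    by (rule nn_integral_area_measure_square) measurable
  also have "\<dots> = (\<integral>\<^sup>+t. ennreal (t powr (real m + 1 - 1) * (1 - t) powr (\<alpha> + 1 - 1)) * indicator {0..1} t \<partial>lborel)"
  proof (rule nn_integral_cong_AE)
    \<comment> \<open>The point 0 is discarded because \<open>0 ^ 0 = 1\<close> whereas
      \<open>0 powr 0 = 0\<close>.\<close>
    show "AE t in lborel. ennreal (t ^ m * (1 - t) powr \<alpha>) * indicator {0..1} t =
        ennreal (t powr (real m + 1 - 1) * (1 - t) powr (\<alpha> + 1 - 1)) * indicator {0..1} t"
      using AE_lborel_singleton[of "0::real"]
      by eventually_elim (auto simp: powr_realpow indicator_def)
  qed
  also have "\<dots> = ennreal (Beta (real m + 1) (\<alpha> + 1))"
    using assms by (intro nn_integral_has_integral_lebesgue' has_integral_Beta_real) auto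
  finally show ?thesis by (simp add: power_mult)
qed

text \<open>Up to replacing m by m + 1 in the power, the sequence is Euler's product
  \<open>Gamma_series\<close>, whose limit is the Gamma function.\<close>

lemma Beta_asymp:
  fixes \<alpha> :: real
  assumes "\<alpha> > -1"
  shows "(\<lambda>m. Beta (real m + 1) (\<alpha> + 1) * (real m + 1) powr (\<alpha> + 1)) \<longlonglongrightarrow> Gamma (\<alpha> + 1)"
proof -
  have eq: "Beta (real m + 1) (\<alpha> + 1) * real m powr (\<alpha> + 1) = Gamma_series (\<alpha> + 1) m" if "m > 0" for m
  proof -
    have a: "\<alpha> + 1 > 0" using assms by simp
    have "Gamma (\<alpha> + 1) \<noteq> 0"
      using Gamma_real_pos[OF a] by simp
    moreover have "pochhammer (\<alpha> + 1) (m + 1) = Gamma (\<alpha> + 1 + real (m + 1)) / Gamma (\<alpha> + 1)"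
      using a by (intro pochhammer_Gamma) (auto dest: nonpos_Ints_nonpos)
    moreover have "\<alpha> + 1 + (real m + 1) > 0" using assms by simp
    then have "Gamma (\<alpha> + 1 + (real m + 1)) > 0" by (rule Gamma_real_pos)
    ultimately show ?thesis
      using that Gamma_fact[of m, where ?'a = real]
      by (simp add: Gamma_series_def Beta_def powr_def add_ac)
  qed
  have 1: "(\<lambda>m. Beta (real m + 1) (\<alpha> + 1) * real m powr (\<alpha> + 1)) \<longlonglongrightarrow> Gamma (\<alpha> + 1)"
    using Gamma_series_LIMSEQ[of "\<alpha> + 1"]
    by (rule Lim_transform_eventually) (rule eventually_mono[OF eventually_gt_at_top[of 0]], rule eq[symmetric])
  have 2: "(\<lambda>m. ((real m + 1) / real m) powr (\<alpha> + 1)) \<longlonglongrightarrow> 1"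
  proof -
    have "(\<lambda>m. (real m + 1) / real m) \<longlonglongrightarrow> 1"
      by real_asymp
    from tendsto_powr[OF this tendsto_const, of "\<alpha> + 1"] show ?thesis by simp
  qed
  have "(\<lambda>m. (Beta (real m + 1) (\<alpha> + 1) * real m powr (\<alpha> + 1)) * ((real m + 1) / real m) powr (\<alpha> + 1))
      \<longlonglongrightarrow> Gamma (\<alpha> + 1) * 1"
    by (intro tendsto_mult 1 2)
  moreover have "\<forall>\<^sub>F m in sequentially.
      (Beta (real m + 1) (\<alpha> + 1) * real m powr (\<alpha> + 1)) * ((real m + 1) / real m) powr (\<alpha> + 1)
       = Beta (real m + 1) (\<alpha> + 1) * (real m + 1) powr (\<alpha> + 1)"
    using eventually_gt_at_top[of 0] by eventually_elim (simp add: powr_divide)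
  ultimately show ?thesis
    using Lim_transform_eventually by fastforce
qed

text \<open>A positive sequence with positive limit is bounded, and so is its reciprocal. Hence the
  asymptotics give constants valid for every m, not only for large m.\<close>

lemma Beta_bounds:
  fixes \<alpha> :: real
  assumes \<alpha>: "\<alpha> > -1"
  obtains c C where "c > 0" "C > 0"
    "\<And>m. c * (real m + 1) powr (- \<alpha> - 1) \<le> Beta (real m + 1) (\<alpha> + 1)"
    "\<And>m. Beta (real m + 1) (\<alpha> + 1) \<le> C * (real m + 1) powr (- \<alpha> - 1)"
proof -
  define x where "x m = Beta (real m + 1) (\<alpha> + 1) * (real m + 1) powr (\<alpha> + 1)" for m
  have lim: "x \<longlonglongrightarrow> Gamma (\<alpha> + 1)"
    unfolding x_def using Beta_asymp[OF \<alpha>] .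
  have G: "Gamma (\<alpha> + 1) > 0" using \<alpha> by (intro Gamma_real_pos) auto
  have pos: "x m > 0" for m
    unfolding x_def Beta_def using \<alpha> by (intro mult_pos_pos divide_pos_pos Gamma_real_pos) auto
  from lim have "Bseq x" by (intro convergent_imp_Bseq) (auto simp: convergent_def)
  then obtain C where C: "C > 0" "\<And>m. norm (x m) \<le> C" by (auto simp: Bseq_def)
  from tendsto_inverse[OF lim] G have "Bseq (\<lambda>m. inverse (x m))"
    by (intro convergent_imp_Bseq) (auto simp: convergent_def)
  then obtain D where D: "D > 0" "\<And>m. norm (inverse (x m)) \<le> D" by (auto simp: Bseq_def)
  have eq: "Beta (real m + 1) (\<alpha> + 1) = x m * (real m + 1) powr (- \<alpha> - 1)" for m
    unfolding x_def by (simp add: mult.assoc flip: powr_add)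
  show thesis
  proof (rule that[of "1 / D" C])
    fix m
    have "1 / D \<le> x m" using D(1) D(2)[of m] pos[of m] by (simp add: field_simps)
    then show "1 / D * (real m + 1) powr (- \<alpha> - 1) \<le> Beta (real m + 1) (\<alpha> + 1)"
      unfolding eq by (intro mult_right_mono) auto
    have "x m \<le> C" using C(2)[of m] by simp
    then show "Beta (real m + 1) (\<alpha> + 1) \<le> C * (real m + 1) powr (- \<alpha> - 1)"
      unfolding eq by (intro mult_right_mono) auto
  qed (use C D in auto)
qed

section \<open>Parseval's identity in the Bergman space\<close>

text \<open>A geometric sum whose ratio is an n-th root of unity. The exponent is an integer because
  differences and negatives of frequencies occur later.\<close>

lemma sum_cis_roots:
  fixes j :: int
  assumes n: "n > 0"
  shows "(\<Sum>k<n. cis (2 * pi * real k * of_int j / real n)) = (if int n dvd j then of_nat n else 0)"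
proof -
  define x where "x = cis (2 * pi * of_int j / real n)"
  have pow: "cis (2 * pi * real k * of_int j / real n) = x ^ k" for k
    by (simp add: x_def Complex.DeMoivre mult_ac)
  have xn: "x ^ n = 1"
    using n cis_multiple_2pi[of "of_int j"] by (simp add: x_def Complex.DeMoivre mult_ac)
  show ?thesis
  proof (cases "x = 1")
    case True
    then have "cos (2 * pi * of_int j / real n) = 1"
      by (simp add: x_def complex_eq_iff)
    then obtain i :: int where "2 * pi * of_int j / real n = of_int i * 2 * pi"
      using cos_one_2pi_int by blast
    then have "real_of_int j = of_int (i * int n)"
      using n by (simp add: field_simps)
    then have "int n dvd j" by (simp only: of_int_eq_iff) auto
    then show ?thesis unfolding pow using True by simp
  next
    case False
    have "\<not> int n dvd j"
    proof
      assume "int n dvd j"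
      then obtain i where "j = int n * i" by auto
      then have "x = cis (2 * pi * of_int i)"
        unfolding x_def by (intro arg_cong[where f = cis]) (use n in simp)
      also have "\<dots> = 1" by (rule cis_multiple_2pi) simp
      finally show False using False by simp
    qed
    then show ?thesis unfolding pow using False xn by (simp add: geometric_sum)
  qed
qed

text \<open>Plancherel's identity for the discrete Fourier transform: expand the squares and use
  orthogonality of the characters.\<close>

lemma sum_cmod_square_roots:
  fixes c :: "nat \<Rightarrow> complex"
  assumes n: "n > 0"
  shows "(\<Sum>k<n. (cmod (\<Sum>m<n. c m * cis (2 * pi * real k * real m / real n)))\<^sup>2)
    = real n * (\<Sum>m<n. (cmod (c m))\<^sup>2)"
proof -
  have cc: "cis (2 * pi * real k * real m / real n) * cnj (cis (2 * pi * real k * real l / real n))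
      = cis (2 * pi * real k * of_int (int m - int l) / real n)" for k m l
    by (simp add: cis_cnj cis_mult algebra_simps diff_divide_distrib)
  have "complex_of_real (\<Sum>k<n. (cmod (\<Sum>m<n. c m * cis (2 * pi * real k * real m / real n)))\<^sup>2)
      = (\<Sum>k<n. \<Sum>m<n. \<Sum>l<n. c m * cnj (c l) *
          (cis (2 * pi * real k * real m / real n) * cnj (cis (2 * pi * real k * real l / real n))))"
    unfolding of_real_sum complex_norm_square cnj_sum sum_product
    by (intro sum.cong refl) (simp add: mult_ac)
  also have "\<dots> = (\<Sum>m<n. \<Sum>l<n. \<Sum>k<n. c m * cnj (c l) * cis (2 * pi * real k * of_int (int m - int l) / real n))"
    unfolding cc by (rule trans[OF sum.swap]) (intro sum.cong refl sum.swap)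
  also have "\<dots> = (\<Sum>m<n. \<Sum>l<n. if l = m then of_nat n * (c m * cnj (c l)) else 0)"
  proof (intro sum.cong refl)
    fix m l assume "m \<in> {..<n}" "l \<in> {..<n}"
    \<comment> \<open>Both indices lie below n, so their difference is a multiple of n only when
      they coincide.\<close>
    then have "\<bar>int m - int l\<bar> < int n" by auto
    then have "int n dvd int m - int l \<longleftrightarrow> l = m"
      using zdvd_not_zless[of "\<bar>int m - int l\<bar>" "int n"] by auto
    then show "(\<Sum>k<n. c m * cnj (c l) * cis (2 * pi * real k * of_int (int m - int l) / real n))
        = (if l = m then of_nat n * (c m * cnj (c l)) else 0)"
      unfolding sum_distrib_left[symmetric] sum_cis_roots[OF n] by simp
  qed
  also have "\<dots> = complex_of_real (real n * (\<Sum>m<n. (cmod (c m))\<^sup>2))"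
    by (simp add: sum_distrib_left flip: complex_norm_square)
  finally show ?thesis by (simp only: of_real_eq_iff)
qed

text \<open>Monomials are orthogonal for every rotation invariant weight. Nonnegative integrals are
  used so that infinite values need no separate treatment.\<close>

lemma nn_integral_polynomial_radial:
  fixes c :: "nat \<Rightarrow> complex" and v :: "complex \<Rightarrow> ennreal"
  assumes [measurable]: "v \<in> borel_measurable borel"
    and rad: "\<And>w z. cmod w = 1 \<Longrightarrow> v (w * z) = v z"
  shows "(\<integral>\<^sup>+z. ennreal ((cmod (\<Sum>m<n. c m * z ^ m))\<^sup>2) * v z \<partial>area_measure)
    = (\<Sum>m<n. ennreal ((cmod (c m))\<^sup>2) * (\<integral>\<^sup>+z. ennreal ((cmod z) ^ (2 * m)) * v z \<partial>area_measure))"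
proof (cases "n = 0")
  case False
  then have n: "n > 0" by simp
  define S where "S z = (\<Sum>m<n. c m * z ^ m)" for z
  have [measurable]: "S \<in> borel_measurable borel"
    unfolding S_def[abs_def] by measurable
  define w where "w k = cis (2 * pi * real k / real n)" for k :: nat
  have S: "S (w k * z) = (\<Sum>m<n. (c m * z ^ m) * cis (2 * pi * real k * real m / real n))" for k z
    unfolding S_def w_def
    by (intro sum.cong refl) (simp add: power_mult_distrib Complex.DeMoivre mult_ac)
  \<comment> \<open>averaging over the rotations by \<open>n\<close>-th roots of unity removes the off-diagonal terms\<close>
  have avg: "(\<Sum>k<n. (cmod (S (w k * z)))\<^sup>2) = real n * (\<Sum>m<n. (cmod (c m))\<^sup>2 * (cmod z) ^ (2 * m))" for z
    unfolding S sum_cmod_square_roots[OF n]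
    by (simp add: norm_mult norm_power power_mult_distrib power_mult mult.commute flip: power_mult)
  \<comment> \<open>By rotation invariance each of the n rotated integrals equals the original one.
    The factor n is cancelled at the end.\<close>
  have "of_nat n * (\<integral>\<^sup>+z. ennreal ((cmod (S z))\<^sup>2) * v z \<partial>area_measure)
      = (\<Sum>k<n. (\<integral>\<^sup>+z. ennreal ((cmod (S (w k * z)))\<^sup>2) * v (w k * z) \<partial>area_measure))"
    by (subst nn_integral_area_measure_rotate[where F = "\<lambda>z. ennreal ((cmod (S z))\<^sup>2) * v z"])
       (simp_all add: w_def)
  also have "\<dots> = (\<integral>\<^sup>+z. (\<Sum>k<n. ennreal ((cmod (S (w k * z)))\<^sup>2) * v z) \<partial>area_measure)"
    by (subst nn_integral_sum) (simp_all add: rad w_def)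
  also have "\<dots> = (\<integral>\<^sup>+z. (of_nat n * (\<Sum>m<n. ennreal ((cmod (c m))\<^sup>2) * (ennreal ((cmod z) ^ (2 * m)) * v z))) \<partial>area_measure)"
  proof (intro nn_integral_cong)
    fix z
    have "(\<Sum>k<n. ennreal ((cmod (S (w k * z)))\<^sup>2) * v z) = ennreal (\<Sum>k<n. (cmod (S (w k * z)))\<^sup>2) * v z"
      by (simp add: sum_distrib_right flip: sum_ennreal)
    also have "\<dots> = of_nat n * (\<Sum>m<n. ennreal ((cmod (c m))\<^sup>2) * (ennreal ((cmod z) ^ (2 * m)) * v z))"
      unfolding avg
      by (simp add: ennreal_mult sum_nonneg sum_distrib_right ennreal_of_nat_eq_real_of_nat mult.assoc flip: sum_ennreal)
    finally show "(\<Sum>k<n. ennreal ((cmod (S (w k * z)))\<^sup>2) * v z) = \<dots>" .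
  qed
  also have "\<dots> = of_nat n * (\<Sum>m<n. ennreal ((cmod (c m))\<^sup>2) * (\<integral>\<^sup>+z. ennreal ((cmod z) ^ (2 * m)) * v z \<partial>area_measure))"
    by (simp add: nn_integral_cmult nn_integral_sum)
  finally show ?thesis
    using n unfolding S_def
    by (subst (asm) ennreal_mult_cancel_left) (auto simp: of_nat_less_top)
qed simp

text \<open>The weight vanishes outside a disc of radius less than 1, where the partial sums are
  uniformly bounded. Dominated convergence then carries the identity over from polynomials.\<close>

lemma nn_integral_power_series_radial:
  fixes c :: "nat \<Rightarrow> complex" and v :: "complex \<Rightarrow> ennreal"
  assumes [measurable]: "v \<in> borel_measurable borel"
    and rad: "\<And>w z. cmod w = 1 \<Longrightarrow> v (w * z) = v z"
    and f: "\<And>z. cmod z < 1 \<Longrightarrow> (\<lambda>m. c m * z ^ m) sums f z"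
    and fin: "(\<integral>\<^sup>+z. v z \<partial>area_measure) < \<infinity>"
    and vfin: "\<And>z. v z < \<infinity>"
    and \<rho>: "\<rho> < 1" "\<And>z. cmod z > \<rho> \<Longrightarrow> v z = 0"
  shows "(\<integral>\<^sup>+z. ennreal ((cmod (f z))\<^sup>2) * v z \<partial>area_measure)
    = (\<Sum>m. ennreal ((cmod (c m))\<^sup>2) * (\<integral>\<^sup>+z. ennreal ((cmod z) ^ (2 * m)) * v z \<partial>area_measure))"
proof -
  define r where "r = max \<rho> 0"
  have r: "0 \<le> r" "r < 1" "\<And>z. cmod z > r \<Longrightarrow> v z = 0" using \<rho> by (auto simp: r_def)
  \<comment> \<open>A point strictly between radius r and the unit circle: convergence at x yields
    absolute convergence at r.\<close>
  define x where "x = complex_of_real ((1 + r) / 2)"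
  have x: "cmod x < 1" "r < cmod x"
    unfolding x_def norm_of_real using r by (auto simp: field_simps)
  have "summable (\<lambda>m. norm (c m * complex_of_real r ^ m))"
    using f[OF x(1)] x(2) r(1) by (intro powser_insidea[of c x]) (auto simp: sums_iff)
  then have sm: "summable (\<lambda>m. cmod (c m) * r ^ m)"
    using r by (simp add: norm_mult norm_power)
  define K where "K = (\<Sum>m. cmod (c m) * r ^ m)"
  define u where "u n z = ennreal ((cmod (\<Sum>m<n. c m * z ^ m))\<^sup>2) * v z" for n z
  have [measurable]: "u n \<in> borel_measurable borel" for n
    unfolding u_def[abs_def] by measurable
  have K: "cmod (\<Sum>m<n. c m * z ^ m) \<le> K" if "cmod z \<le> r" for n z
  proof -
    have "cmod (\<Sum>m<n. c m * z ^ m) \<le> (\<Sum>m<n. cmod (c m) * r ^ m)"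
      using that by (intro sum_norm_le) (auto simp: norm_mult norm_power intro!: mult_left_mono power_mono)
    also have "\<dots> \<le> K"
      unfolding K_def using sm r by (intro sum_le_suminf) auto
    finally show ?thesis .
  qed
  have lim: "(\<lambda>n. u n z) \<longlonglongrightarrow> ennreal ((cmod (f z))\<^sup>2) * v z" for z
  proof (cases "cmod z > r \<or> v z = 0")
    case False
    then have "(\<lambda>n. \<Sum>m<n. c m * z ^ m) \<longlonglongrightarrow> f z"
      using f[of z] r by (simp add: sums_def)
    then have "(\<lambda>n. (cmod (\<Sum>m<n. c m * z ^ m))\<^sup>2) \<longlonglongrightarrow> (cmod (f z))\<^sup>2"
      by (intro tendsto_intros)
    then have "(\<lambda>n. ennreal ((cmod (\<Sum>m<n. c m * z ^ m))\<^sup>2)) \<longlonglongrightarrow> ennreal ((cmod (f z))\<^sup>2)"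
      by (rule tendsto_ennrealI)
    then have "(\<lambda>n. v z * ennreal ((cmod (\<Sum>m<n. c m * z ^ m))\<^sup>2)) \<longlonglongrightarrow> v z * ennreal ((cmod (f z))\<^sup>2)"
      by (intro ennreal_tendsto_cmult) (use vfin[of z] in \<open>simp add: less_top\<close>)
    then show ?thesis by (simp add: u_def mult.commute)
  qed (use r(3) in \<open>auto simp: u_def\<close>)
  have ms: "(\<lambda>z. ennreal ((cmod (f z))\<^sup>2) * v z) \<in> borel_measurable borel"
    by (rule borel_measurable_LIMSEQ_order[OF lim]) measurable
  have "(\<lambda>n. \<integral>\<^sup>+z. u n z \<partial>area_measure) \<longlonglongrightarrow> (\<integral>\<^sup>+z. ennreal ((cmod (f z))\<^sup>2) * v z \<partial>area_measure)"
  proof (rule nn_integral_dominated_convergence[where w = "\<lambda>z. ennreal (K\<^sup>2) * v z"])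
    show "(\<integral>\<^sup>+z. ennreal (K\<^sup>2) * v z \<partial>area_measure) < \<infinity>"
      using fin by (simp add: nn_integral_cmult ennreal_mult_less_top)
    show "AE z in area_measure. u j z \<le> ennreal (K\<^sup>2) * v z" for j
    proof (rule AE_I2)
      fix z
      show "u j z \<le> ennreal (K\<^sup>2) * v z"
      proof (cases "cmod z > r")
        case False
        then show ?thesis unfolding u_def
          using K[of z j] by (intro mult_right_mono ennreal_leI power_mono) auto
      qed (simp add: u_def r(3))
    qed
    show "(\<lambda>z. ennreal ((cmod (f z))\<^sup>2) * v z) \<in> borel_measurable area_measure"
      using ms by simp
  qed (use lim in auto)
  then have "(\<lambda>n. \<Sum>m<n. ennreal ((cmod (c m))\<^sup>2) * (\<integral>\<^sup>+z. ennreal ((cmod z) ^ (2 * m)) * v z \<partial>area_measure))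
      \<longlonglongrightarrow> (\<integral>\<^sup>+z. ennreal ((cmod (f z))\<^sup>2) * v z \<partial>area_measure)"
    unfolding u_def by (subst (asm) nn_integral_polynomial_radial) (auto simp: rad)
  then show ?thesis
    unfolding sums_def[symmetric] by (rule sums_unique)
qed

lemma nn_integral_area_measure_ball:
  fixes F :: "complex \<Rightarrow> ennreal"
  assumes [measurable]: "F \<in> borel_measurable borel"
  shows "(\<integral>\<^sup>+z. F z * indicator (ball 0 1) z \<partial>area_measure) = (\<integral>\<^sup>+z. F z \<partial>area_measure)"
proof -
  have "(\<lambda>z. F z * indicator (ball 0 1) z) \<in> borel_measurable borel"
    by (intro borel_measurable_times_ennreal borel_measurable_indicator assms) simp
  then show ?thesis
    by (simp add: nn_integral_area_measure mult.assoc flip: indicator_inter_arith)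
qed

text \<open>The weight is cut off to closed discs exhausting the unit disc. Monotone convergence
  removes the cutoff on both sides of the identity, and the remaining radial moments are Beta
  values.\<close>

lemma bergman_parseval_nn_integral:
  fixes c :: "nat \<Rightarrow> complex"
  assumes \<alpha>: "\<alpha> > -1" and f: "\<And>z. cmod z < 1 \<Longrightarrow> (\<lambda>m. c m * z ^ m) sums f z"
  shows "(\<integral>\<^sup>+z. ennreal ((cmod (f z))\<^sup>2 * (1 - (cmod z)\<^sup>2) powr \<alpha>) * indicator (ball 0 1) z \<partial>area_measure)
    = (\<Sum>m. ennreal ((cmod (c m))\<^sup>2 * Beta (real m + 1) (\<alpha> + 1)))"
proof -
  define \<rho> where "\<rho> i = 1 - 1 / (real i + 2)" for i :: nat
  define h where "h z = ennreal ((1 - (cmod z)\<^sup>2) powr \<alpha>)" for z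
  define v where "v i z = h z * indicator (cball 0 (\<rho> i)) z" for i z
  have [measurable]: "h \<in> borel_measurable borel"
    unfolding h_def[abs_def] by measurable
  have [measurable]: "v i \<in> borel_measurable borel" for i
    unfolding v_def[abs_def] by (intro borel_measurable_times_ennreal borel_measurable_indicator) simp_all
  have \<rho>1: "\<rho> i < 1" for i by (simp add: \<rho>_def)
  have mono: "\<rho> i \<le> \<rho> j" if "i \<le> j" for i j
    using that by (simp add: \<rho>_def frac_le)
  have incv: "incseq (\<lambda>i. v i z)" for z
    unfolding v_def by (intro incseq_SucI mult_left_mono) (use mono[of _ "Suc _"] in \<open>auto simp: indicator_def intro: order_trans\<close>)
  have supv: "(SUP i. v i z) = h z * indicator (ball 0 1) z" for z
  proof (cases "z \<in> ball 0 1")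
    case True
    then have "1 - cmod z > 0" by simp
    then obtain i where "inverse (real (Suc i)) < 1 - cmod z"
      using reals_Archimedean by blast
    moreover have "1 / (real i + 2) \<le> inverse (real (Suc i))"
      by (simp add: field_simps)
    ultimately have "z \<in> cball 0 (\<rho> i)" by (simp add: \<rho>_def)
    then have "v i z = h z" by (simp add: v_def)
    moreover have "v j z \<le> h z" for j by (simp add: v_def indicator_def)
    ultimately have "(SUP i. v i z) = h z"
      by (intro antisym SUP_least) (auto intro: SUP_upper2[of i])
    then show ?thesis using True by simp
  next
    case False
    then have "v i z = 0" for i
      using \<rho>1[of i] by (simp add: v_def indicator_def)
    then show ?thesis using False by simp
  qed
  have hint: "(\<integral>\<^sup>+z. ennreal ((cmod z) ^ (2 * m)) * h z \<partial>area_measure) = ennreal (Beta (real m + 1) (\<alpha> + 1))" for m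
    using Beta_eq_nn_integral_area_measure[OF \<alpha>, of m] by (simp add: h_def ennreal_mult)
  \<comment> \<open>Nothing is known about f off the unit disc, so measurability is obtained after
    the cutoff, from continuity on the closed disc.\<close>
  have fm: "(\<lambda>z. ennreal ((cmod (f z))\<^sup>2) * v i z) \<in> borel_measurable borel" for i
  proof -
    have "f holomorphic_on ball 0 1"
      by (rule power_series_holomorphic[of 0 1 c]) (use f in simp)
    then have "continuous_on (cball 0 (\<rho> i)) (\<lambda>z. (cmod (f z))\<^sup>2)"
      using \<rho>1[of i]
      by (intro continuous_intros holomorphic_on_imp_continuous_on) (auto elim!: holomorphic_on_subset)
    then have [measurable]: "(\<lambda>z. indicator (cball 0 (\<rho> i)) z *\<^sub>R (cmod (f z))\<^sup>2) \<in> borel_measurable borel"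
      by (intro borel_measurable_continuous_on_indicator) auto
    have "(\<lambda>z. ennreal (indicator (cball 0 (\<rho> i)) z *\<^sub>R (cmod (f z))\<^sup>2) * h z) \<in> borel_measurable borel"
      by measurable
    also have "(\<lambda>z. ennreal (indicator (cball 0 (\<rho> i)) z *\<^sub>R (cmod (f z))\<^sup>2) * h z) = (\<lambda>z. ennreal ((cmod (f z))\<^sup>2) * v i z)"
      by (auto simp: fun_eq_iff v_def indicator_def)
    finally show ?thesis .
  qed
  have trunc: "(\<integral>\<^sup>+z. ennreal ((cmod (f z))\<^sup>2) * v i z \<partial>area_measure)
      = (\<Sum>m. ennreal ((cmod (c m))\<^sup>2) * (\<integral>\<^sup>+z. ennreal ((cmod z) ^ (2 * m)) * v i z \<partial>area_measure))" for i
  proof (rule nn_integral_power_series_radial[OF _ _ f _ _ \<rho>1[of i]])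
    have "(\<integral>\<^sup>+z. v i z \<partial>area_measure) \<le> (\<integral>\<^sup>+z. h z \<partial>area_measure)"
      by (intro nn_integral_mono) (simp add: v_def indicator_def)
    also have "\<dots> < \<infinity>" using hint[of 0] by simp
    finally show "(\<integral>\<^sup>+z. v i z \<partial>area_measure) < \<infinity>" .
  qed (auto simp: v_def h_def indicator_def norm_mult)
  have "(\<integral>\<^sup>+z. ennreal ((cmod (f z))\<^sup>2 * (1 - (cmod z)\<^sup>2) powr \<alpha>) * indicator (ball 0 1) z \<partial>area_measure)
      = (\<integral>\<^sup>+z. (SUP i. ennreal ((cmod (f z))\<^sup>2) * v i z) \<partial>area_measure)"
    by (simp add: supv h_def ennreal_mult mult.assoc flip: SUP_mult_left_ennreal)
  also have "\<dots> = (SUP i. \<integral>\<^sup>+z. ennreal ((cmod (f z))\<^sup>2) * v i z \<partial>area_measure)"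
    using incv fm by (intro nn_integral_monotone_convergence_SUP) (auto simp: incseq_def le_fun_def intro!: mult_left_mono)
  also have "\<dots> = (\<Sum>m. SUP i. ennreal ((cmod (c m))\<^sup>2) * (\<integral>\<^sup>+z. ennreal ((cmod z) ^ (2 * m)) * v i z \<partial>area_measure))"
    unfolding trunc using incv
    by (intro ennreal_suminf_SUP_eq[symmetric]) (auto simp: incseq_def intro!: mult_left_mono nn_integral_mono)
  also have "\<dots> = (\<Sum>m. ennreal ((cmod (c m))\<^sup>2) * ennreal (Beta (real m + 1) (\<alpha> + 1)))"
  proof (intro suminf_cong)
    fix m
    have "(SUP i. \<integral>\<^sup>+z. ennreal ((cmod z) ^ (2 * m)) * v i z \<partial>area_measure)
        = (\<integral>\<^sup>+z. (SUP i. ennreal ((cmod z) ^ (2 * m)) * v i z) \<partial>area_measure)"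
      using incv by (intro nn_integral_monotone_convergence_SUP[symmetric])
        (auto simp: incseq_def le_fun_def intro!: mult_left_mono)
    also have "\<dots> = (\<integral>\<^sup>+z. (ennreal ((cmod z) ^ (2 * m)) * h z) * indicator (ball 0 1) z \<partial>area_measure)"
      by (simp add: supv mult.assoc flip: SUP_mult_left_ennreal)
    also have "\<dots> = (\<integral>\<^sup>+z. ennreal ((cmod z) ^ (2 * m)) * h z \<partial>area_measure)"
      by (rule nn_integral_area_measure_ball) measurable
    finally show "(SUP i. ennreal ((cmod (c m))\<^sup>2) * (\<integral>\<^sup>+z. ennreal ((cmod z) ^ (2 * m)) * v i z \<partial>area_measure))
        = ennreal ((cmod (c m))\<^sup>2) * ennreal (Beta (real m + 1) (\<alpha> + 1))"
      by (simp add: hint flip: SUP_mult_left_ennreal)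
  qed
  finally show ?thesis by (simp add: ennreal_mult')
qed

section \<open>The Bergman norm in terms of Taylor coefficients\<close>

definition disc_series :: "(nat \<Rightarrow> complex) \<Rightarrow> (complex \<Rightarrow> complex) \<Rightarrow> bool" where
  "disc_series c f \<longleftrightarrow> (\<forall>z. cmod z < 1 \<longrightarrow> (\<lambda>m. c m * z ^ m) sums f z)"

lemma disc_seriesD: "disc_series c f \<Longrightarrow> cmod z < 1 \<Longrightarrow> (\<lambda>m. c m * z ^ m) sums f z"
  by (simp add: disc_series_def)

lemma disc_series_holomorphic: "disc_series c f \<Longrightarrow> f holomorphic_on ball 0 1"
  by (rule power_series_holomorphic[of 0 1 c]) (simp add: disc_series_def)

lemma disc_series_diff:
  "disc_series c f \<Longrightarrow> disc_series d g \<Longrightarrow> disc_series (\<lambda>m. c m - d m) (\<lambda>z. f z - g z)"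
  unfolding disc_series_def by (auto simp: left_diff_distrib intro: sums_diff)

text \<open>Multiplied by \<open>\<alpha> + 1\<close>, this is the squared Bergman norm of the m-th
  monomial.\<close>

definition bergman_weight :: "real \<Rightarrow> nat \<Rightarrow> real" where
  "bergman_weight \<alpha> m = Beta (real m + 1) (\<alpha> + 1)"

lemma bergman_weight_pos: "\<alpha> > -1 \<Longrightarrow> bergman_weight \<alpha> m > 0"
  unfolding bergman_weight_def Beta_def by (intro mult_pos_pos divide_pos_pos Gamma_real_pos) auto

text \<open>Both claims come from one identity in the extended nonnegative reals: the integral is
  finite exactly when the series is, and then the real values agree.\<close>

lemma
  fixes c :: "nat \<Rightarrow> complex"
  assumes \<alpha>: "\<alpha> > -1" and f: "disc_series c f"
  shows bergman_integrable_iff_summable: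
    "set_integrable area_measure (ball 0 1) (\<lambda>z. (cmod (f z))\<^sup>2 * (1 - (cmod z)\<^sup>2) powr \<alpha>)
      \<longleftrightarrow> summable (\<lambda>m. (cmod (c m))\<^sup>2 * bergman_weight \<alpha> m)" (is "?I \<longleftrightarrow> ?S")
    and bergman_norm_eq_suminf:
    "summable (\<lambda>m. (cmod (c m))\<^sup>2 * bergman_weight \<alpha> m) \<Longrightarrow>
      bergman_norm \<alpha> f = sqrt ((\<alpha> + 1) * (\<Sum>m. (cmod (c m))\<^sup>2 * bergman_weight \<alpha> m))"
proof -
  define g where "g z = indicator (ball 0 1) z *\<^sub>R ((cmod (f z))\<^sup>2 * (1 - (cmod z)\<^sup>2) powr \<alpha>)" for z
  have g0: "g z \<ge> 0" for z by (simp add: g_def)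
  from weighted_measurable[OF disc_series_holomorphic[OF f], of \<alpha>] have m: "g \<in> borel_measurable area_measure"
    unfolding set_borel_measurable_def g_def .
  define b where "b m = (cmod (c m))\<^sup>2 * bergman_weight \<alpha> m" for m
  have b0: "b m \<ge> 0" for m
    using bergman_weight_pos[OF \<alpha>, of m] by (simp add: b_def)
  have nn: "(\<integral>\<^sup>+z. ennreal (g z) \<partial>area_measure) = (\<Sum>m. ennreal (b m))"
  proof -
    have "(\<integral>\<^sup>+z. ennreal (g z) \<partial>area_measure)
        = (\<integral>\<^sup>+z. ennreal ((cmod (f z))\<^sup>2 * (1 - (cmod z)\<^sup>2) powr \<alpha>) * indicator (ball 0 1) z \<partial>area_measure)"
      by (intro nn_integral_cong) (simp add: g_def indicator_def)
    also have "\<dots> = (\<Sum>m. ennreal (b m))"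
      unfolding b_def bergman_weight_def by (rule bergman_parseval_nn_integral[OF \<alpha> disc_seriesD[OF f]])
    finally show ?thesis .
  qed
  have I: "?I \<longleftrightarrow> integrable area_measure g"
    by (simp add: set_integrable_def g_def[abs_def])
  have sum_ennreal: "(\<Sum>m. ennreal (b m)) = ennreal (\<Sum>m. b m)" if "summable b"
    using that b0 by (intro suminf_ennreal2) auto
  show "?I \<longleftrightarrow> ?S"
  proof
    assume ?I
    then have "(\<Sum>m. ennreal (b m)) \<noteq> top"
      using nn_integral_eq_integral[of area_measure g] g0 nn unfolding I by simp
    then have "summable b" using summable_suminf_not_top[of b] b0 by blast
    then show ?S by (simp add: b_def[abs_def])
  next
    assume ?S
    then have "summable b" by (simp add: b_def[abs_def])
    then show ?I unfolding I
      using m nn sum_ennreal g0 by (intro integrableI_nonneg) auto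
  qed
  assume ?S
  then have s: "summable b" by (simp add: b_def[abs_def])
  have "(LINT z|area_measure. g z) = enn2real (\<integral>\<^sup>+z. ennreal (g z) \<partial>area_measure)"
    using m g0 by (intro integral_eq_nn_integral) auto
  then have "(LINT z|area_measure. g z) = (\<Sum>m. b m)"
    using s b0 by (simp add: nn sum_ennreal suminf_nonneg)
  then show "bergman_norm \<alpha> f = sqrt ((\<alpha> + 1) * (\<Sum>m. (cmod (c m))\<^sup>2 * bergman_weight \<alpha> m))"
    by (simp add: bergman_norm_def set_lebesgue_integral_def g_def b_def)
qed

section \<open>Power sums and the norm of simple partial fractions\<close>

text \<open>Conjugates appear because on the unit circle they are the inverses of the poles, in
  whose powers the partial fractions expand.\<close>

definition power_sum :: "nat \<Rightarrow> (nat \<Rightarrow> complex) \<Rightarrow> nat \<Rightarrow> complex" where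
  "power_sum n a j = (\<Sum>k<n. cnj (a k) ^ j)"

definition SF_coeff :: "nat \<Rightarrow> nat \<Rightarrow> (nat \<Rightarrow> complex) \<Rightarrow> nat \<Rightarrow> complex" where
  "SF_coeff N n a m = (-1) ^ N * of_nat ((m + N - 1) choose (N - 1)) * power_sum n a (m + N)"

text \<open>Since a has modulus 1, \<open>z - a = - a * (1 - cnj a * z)\<close>, and the negative
  binomial series applies to the second factor.\<close>

lemma inverse_power_sums:
  fixes a z :: complex
  assumes a: "cmod a = 1" and z: "cmod z < 1" and N: "N \<ge> 1"
  shows "(\<lambda>m. (-1) ^ N * of_nat ((m + N - 1) choose (N - 1)) * cnj a ^ (m + N) * z ^ m) sums (1 / (z - a) ^ N)"
proof -
  define w where "w = - (cnj a * z)"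
  have aa: "a * cnj a = 1" using a by (simp add: complex_norm_square[symmetric])
  have w: "cmod w < 1" using a z by (simp add: w_def norm_mult)
  have nz: "1 + w \<noteq> 0" using w by (metis add_eq_0_iff norm_minus_cancel norm_one less_irrefl)
  have ch: "(- of_nat N gchoose m) * w ^ m = of_nat ((m + N - 1) choose (N - 1)) * cnj a ^ m * z ^ m" for m
  proof -
    have "(of_nat N + of_nat m - 1 :: complex) = of_nat (m + N - 1)"
      using N by (simp add: of_nat_diff)
    then have "(- of_nat N gchoose m :: complex) = (-1) ^ m * of_nat ((m + N - 1) choose m)"
      by (simp add: gbinomial_minus binomial_gbinomial)
    also have "(m + N - 1) choose m = (m + N - 1) choose (N - 1)"
      using N binomial_symmetric[of m "m + N - 1"] by simp
    finally have "(- of_nat N gchoose m :: complex) = (-1) ^ m * of_nat ((m + N - 1) choose (N - 1))" .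
    moreover have "w ^ m = (-1) ^ m * (cnj a ^ m * z ^ m)"
      by (simp add: w_def power_minus[of "cnj a * z"] power_mult_distrib)
    moreover have "(-1) ^ m * (-1) ^ m = (1 :: complex)"
      by (simp flip: power_mult_distrib)
    ultimately show ?thesis by (simp add: mult_ac)
  qed
  have pw: "(1 + w) powr (- of_nat N) = 1 / (1 + w) ^ N"
    using nz by (simp add: powr_minus powr_nat divide_inverse)
  have "z - a = - a * (1 + w)"
    using aa by (simp add: w_def algebra_simps mult.assoc[symmetric])
  then have "(z - a) ^ N = (- a) ^ N * (1 + w) ^ N"
    by (simp only: power_mult_distrib)
  moreover have "(- cnj a) ^ N * (- a) ^ N = 1"
    using aa by (simp add: mult.commute flip: power_mult_distrib)
  then have "(- cnj a) ^ N = 1 / (- a) ^ N"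
    by (metis mult_zero_right nonzero_eq_divide_eq zero_neq_one)
  ultimately have eq: "1 / (z - a) ^ N = (- cnj a) ^ N * (1 / (1 + w) ^ N)"
    by simp
  have "(\<lambda>m. (- cnj a) ^ N * ((- of_nat N gchoose m) * w ^ m)) sums ((- cnj a) ^ N * ((1 + w) powr (- of_nat N)))"
    by (intro sums_mult gen_binomial_complex w)
  then show ?thesis
    unfolding pw ch eq by (simp add: power_minus[of "cnj a"] power_add mult_ac)
qed

lemma SF_sums:
  assumes "\<And>k. k < n \<Longrightarrow> cmod (a k) = 1" "N \<ge> 1" "cmod z < 1"
  shows "(\<lambda>m. SF_coeff N n a m * z ^ m) sums (\<Sum>k<n. 1 / (z - a k) ^ N)"
proof -
  have "(\<lambda>m. \<Sum>k<n. (-1) ^ N * of_nat ((m + N - 1) choose (N - 1)) * cnj (a k) ^ (m + N) * z ^ m)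
      sums (\<Sum>k<n. 1 / (z - a k) ^ N)"
    using assms by (intro sums_sum inverse_power_sums) auto
  then show ?thesis
    by (simp add: SF_coeff_def power_sum_def sum_distrib_left sum_distrib_right)
qed

section \<open>Mean square lower bound for power sums\<close>

text \<open>For a matrix V with adjoint V*, the products V* V and V V* have the same Hilbert-Schmidt
  norm. Both sides are the same fourfold sum in different orders.\<close>

lemma gram_sum:
  fixes V :: "nat \<Rightarrow> nat \<Rightarrow> complex"
  shows "(\<Sum>r<L. \<Sum>s<L. (cmod (\<Sum>k<n. cnj (V k r) * V k s))\<^sup>2)
    = (\<Sum>k<n. \<Sum>l<n. (cmod (\<Sum>r<L. V k r * cnj (V l r)))\<^sup>2)"
proof -
  define X where "X r s k l = cnj (V k r) * V k s * (V l r * cnj (V l s))" for r s k l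
  have "complex_of_real (\<Sum>r<L. \<Sum>s<L. (cmod (\<Sum>k<n. cnj (V k r) * V k s))\<^sup>2)
      = (\<Sum>r<L. \<Sum>s<L. \<Sum>k<n. \<Sum>l<n. X r s k l)"
    unfolding of_real_sum complex_norm_square cnj_sum sum_product X_def by (simp add: mult_ac)
  also have "\<dots> = (\<Sum>r<L. \<Sum>k<n. \<Sum>l<n. \<Sum>s<L. X r s k l)"
    by (rule sum.cong[OF refl], rule trans[OF sum.swap], rule sum.cong[OF refl], rule sum.swap)
  also have "\<dots> = (\<Sum>k<n. \<Sum>l<n. \<Sum>r<L. \<Sum>s<L. X r s k l)"
    by (rule trans[OF sum.swap], rule sum.cong[OF refl], rule sum.swap)
  also have "\<dots> = (\<Sum>k<n. \<Sum>l<n. \<Sum>s<L. \<Sum>r<L. X r s k l)"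
    by (rule sum.cong[OF refl], rule sum.cong[OF refl], rule sum.swap)
  also have "\<dots> = complex_of_real (\<Sum>k<n. \<Sum>l<n. (cmod (\<Sum>r<L. V k r * cnj (V l r)))\<^sup>2)"
    unfolding of_real_sum complex_norm_square cnj_sum sum_product X_def by (simp add: mult_ac)
  finally show ?thesis by (simp only: of_real_eq_iff)
qed

text \<open>Apply \<open>gram_sum\<close> to the Vandermonde matrix with entries
  \<open>a k ^ r\<close>. One Gram matrix is a Toeplitz matrix of power sums; the other has n
  diagonal entries equal to L, contributing \<open>n * L ^ 2\<close>.\<close>

lemma power_sum_square_lower_bound:
  assumes a: "\<And>k. k < n \<Longrightarrow> cmod (a k) = 1"
  shows "real n * real L \<le> 2 * (\<Sum>j<L. (cmod (power_sum n a j))\<^sup>2)"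
proof (cases "L = 0")
  case False
  define P where "P j = (cmod (power_sum n a j))\<^sup>2" for j
  have P0: "P j \<ge> 0" for j by (simp add: P_def)
  have aa: "cnj (a k) * a k = 1" if "k < n" for k
    using a[OF that] by (simp add: complex_norm_square[symmetric] mult.commute)
  have prod: "cnj (a k) ^ r * a k ^ s = (if s \<le> r then cnj (a k) ^ (r - s) else a k ^ (s - r))" if "k < n" for k r s
  proof (cases "s \<le> r")
    case True
    then have "cnj (a k) ^ r = cnj (a k) ^ (r - s) * cnj (a k) ^ s" by (simp flip: power_add)
    then show ?thesis using True aa[OF that] by (simp add: mult.assoc flip: power_mult_distrib)
  next
    case False
    then have "a k ^ s = a k ^ r * a k ^ (s - r)" by (simp flip: power_add)
    then show ?thesis using False aa[OF that] by (simp add: mult.assoc[symmetric] flip: power_mult_distrib)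
  qed
  have entry: "(cmod (\<Sum>k<n. cnj (a k ^ r) * a k ^ s))\<^sup>2 = (if s \<le> r then P (r - s) else P (s - r))" for r s
  proof -
    have "(\<Sum>k<n. cnj (a k ^ r) * a k ^ s) = (\<Sum>k<n. if s \<le> r then cnj (a k) ^ (r - s) else a k ^ (s - r))"
      by (intro sum.cong refl) (simp add: prod)
    also have "\<dots> = (if s \<le> r then power_sum n a (r - s) else cnj (power_sum n a (s - r)))"
      by (simp add: power_sum_def cnj_sum)
    finally show ?thesis by (simp add: P_def)
  qed
  \<comment> \<open>In row r each distance between r and s occurs at most twice, once on either side
    of the diagonal.\<close>
  have row: "(\<Sum>s<L. if s \<le> r then P (r - s) else P (s - r)) \<le> 2 * (\<Sum>j<L. P j)" if "r < L" for r
  proof -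
    have "(\<Sum>s<L. if s \<le> r then P (r - s) else P (s - r))
        = (\<Sum>s\<in>{..<L} \<inter> {s. s \<le> r}. P (r - s)) + (\<Sum>s\<in>{..<L} \<inter> - {s. s \<le> r}. P (s - r))"
      by (rule sum.If_cases) simp
    also have "(\<Sum>s\<in>{..<L} \<inter> {s. s \<le> r}. P (r - s)) = sum P ((\<lambda>s. r - s) ` ({..<L} \<inter> {s. s \<le> r}))"
      by (subst sum.reindex) (auto simp: inj_on_def)
    also have "\<dots> \<le> (\<Sum>j<L. P j)"
      using P0 that by (intro sum_mono2) auto
    also have "(\<Sum>s\<in>{..<L} \<inter> - {s. s \<le> r}. P (s - r)) = sum P ((\<lambda>s. s - r) ` ({..<L} \<inter> - {s. s \<le> r}))"
      by (subst sum.reindex) (auto simp: inj_on_def)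
    also have "\<dots> \<le> (\<Sum>j<L. P j)"
      using P0 that by (intro sum_mono2) auto
    finally show ?thesis by simp
  qed
  have "real n * real L ^ 2 = (\<Sum>k<n. (cmod (\<Sum>r<L. a k ^ r * cnj (a k ^ r)))\<^sup>2)"
  proof -
    have "(\<Sum>r<L. a k ^ r * cnj (a k ^ r)) = of_nat L" if "k < n" for k
      using aa[OF that] by (simp add: mult.commute flip: power_mult_distrib)
    then show ?thesis by simp
  qed
  \<comment> \<open>The off-diagonal terms are squares, so adding them only increases the
    sum.\<close>
  also have "\<dots> \<le> (\<Sum>k<n. \<Sum>l<n. (cmod (\<Sum>r<L. a k ^ r * cnj (a l ^ r)))\<^sup>2)"
  proof (rule sum_mono)
    fix k assume "k \<in> {..<n}"
    then show "(cmod (\<Sum>r<L. a k ^ r * cnj (a k ^ r)))\<^sup>2 \<le> (\<Sum>l<n. (cmod (\<Sum>r<L. a k ^ r * cnj (a l ^ r)))\<^sup>2)"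
      by (intro member_le_sum[of k "{..<n}" "\<lambda>l. (cmod (\<Sum>r<L. a k ^ r * cnj (a l ^ r)))\<^sup>2"]) auto
  qed
  also have "\<dots> = (\<Sum>r<L. \<Sum>s<L. if s \<le> r then P (r - s) else P (s - r))"
    unfolding gram_sum[of "\<lambda>k r. a k ^ r", symmetric] entry ..
  also have "\<dots> \<le> (\<Sum>r<L. 2 * (\<Sum>j<L. P j))"
    by (intro sum_mono row) auto
  finally have "real L * (real n * real L) \<le> real L * (2 * (\<Sum>j<L. P j))"
    by (simp add: power2_eq_square mult_ac)
  then show ?thesis
    using False unfolding P_def by (simp add: mult_le_cancel_left)
qed (simp add: sum_nonneg)

lemma cmod_power_sum_le:
  assumes "\<And>k. k < n \<Longrightarrow> cmod (a k) = 1"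
  shows "cmod (power_sum n a j) \<le> real n"
proof -
  have "cmod (power_sum n a j) \<le> (\<Sum>k<n. 1)"
    unfolding power_sum_def using assms by (intro sum_norm_le) (simp add: norm_power)
  then show ?thesis by simp
qed

text \<open>With \<open>L = 4 * N * n\<close> the preceding bound gives \<open>2 * N * n ^ 2\<close>
  for the sum over all indices below L. The first N power sums, which the Taylor coefficients do not
  see, account for at most half of this.\<close>

lemma power_sum_tail_lower_bound:
  assumes a: "\<And>k. k < n \<Longrightarrow> cmod (a k) = 1" and N: "N \<ge> 1" and n: "n \<ge> 1"
  shows "real N * (real n)\<^sup>2 \<le> (\<Sum>m<4 * N * n. (cmod (power_sum n a (m + N)))\<^sup>2)"
proof -
  define P where "P j = (cmod (power_sum n a j))\<^sup>2" for j
  let ?L = "4 * N * n"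
  have NL: "N \<le> ?L" using n N by simp
  have "4 * real N * (real n)\<^sup>2 = real n * real ?L" by (simp add: power2_eq_square)
  also have "\<dots> \<le> 2 * (\<Sum>j<?L. P j)"
    unfolding P_def by (rule power_sum_square_lower_bound[OF a])
  also have "(\<Sum>j<?L. P j) = (\<Sum>j<N. P j) + (\<Sum>j=N..<?L. P j)"
    using NL by (simp add: lessThan_atLeast0 sum.atLeastLessThan_concat)
  also have "(\<Sum>j<N. P j) \<le> (\<Sum>j<N. (real n)\<^sup>2)"
    unfolding P_def using cmod_power_sum_le[of n a, OF a] by (intro sum_mono power_mono) auto
  also have "(\<Sum>j=N..<?L. P j) = (\<Sum>m<?L - N. P (m + N))"
    using sum.shift_bounds_nat_ivl[of P 0 N "?L - N"] NL by (simp add: lessThan_atLeast0)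
  also have "\<dots> \<le> (\<Sum>m<?L. P (m + N))"
    by (intro sum_mono2) (auto simp: P_def)
  finally show ?thesis by (simp add: P_def algebra_simps)
qed

text \<open>The binomial coefficient is comparable to the power N - 1 of m + 1, the weight to the
  power \<open>- \<alpha> - 1\<close>. Squaring the first and adding exponents gives
  \<open>2 * N - 3 - \<alpha>\<close>.\<close>

lemma binomial_weight_bounds:
  fixes \<alpha> :: real
  assumes \<alpha>: "\<alpha> > -1" and N: "N \<ge> 1"
  obtains c C where "c > 0" "C > 0"
    "\<And>m. c * (real m + 1) powr (2 * real N - 3 - \<alpha>) \<le> (real ((m + N - 1) choose (N - 1)))\<^sup>2 * bergman_weight \<alpha> m"
    "\<And>m. (real ((m + N - 1) choose (N - 1)))\<^sup>2 * bergman_weight \<alpha> m \<le> C * (real m + 1) powr (2 * real N - 3 - \<alpha>)"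
proof -
  obtain c C where c: "c > 0" "C > 0"
    "\<And>m. c * (real m + 1) powr (- \<alpha> - 1) \<le> bergman_weight \<alpha> m"
    "\<And>m. bergman_weight \<alpha> m \<le> C * (real m + 1) powr (- \<alpha> - 1)"
    using Beta_bounds[OF \<alpha>] unfolding bergman_weight_def by metis
  define B where "B m = real ((m + N - 1) choose (N - 1))" for m
  define K where "K = real N ^ (N - 1)"
  have K: "K > 0" using N by (simp add: K_def)
  have up: "B m \<le> K * (real m + 1) ^ (N - 1)" for m
  proof -
    have "B m \<le> real ((m + N - 1) ^ (N - 1))"
      unfolding B_def using binomial_le_pow[of "N - 1" "m + N - 1"] N by (intro of_nat_mono) simp
    also have "\<dots> \<le> (real N * (real m + 1)) ^ (N - 1)"
    proof -
      have "real (m + N - 1) \<le> real (N * (m + 1))" using N by (intro of_nat_mono) (cases N, auto)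
      then have "real (m + N - 1) \<le> real N * (real m + 1)"
        by (simp add: algebra_simps)
      then show ?thesis unfolding of_nat_power by (intro power_mono) auto
    qed
    finally show ?thesis by (simp add: K_def power_mult_distrib)
  qed
  have lo: "(real m + 1) ^ (N - 1) / K \<le> B m" for m
  \<comment> \<open>The case N = 1 is split off because the estimate divides by N - 1.\<close>
  proof (cases "N = 1")
    case False
    have "(real m + 1) * (real N - 1) \<le> real (m + N - 1) * real N"
      using N False by (intro mult_mono) auto
    then have "(real m + 1) / real N \<le> real (m + N - 1) / real (N - 1)"
      using False N by (simp add: divide_simps of_nat_diff)
    then have "((real m + 1) / real N) ^ (N - 1) \<le> (real (m + N - 1) / real (N - 1)) ^ (N - 1)"
      by (intro power_mono) auto
    also have "\<dots> \<le> B m"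
      unfolding B_def using N by (intro binomial_ge_n_over_k_pow_k) simp
    finally show ?thesis by (simp add: K_def power_divide)
  qed (simp add: B_def K_def)
  have pw: "((real m + 1) ^ (N - 1))\<^sup>2 * (real m + 1) powr (- \<alpha> - 1) = (real m + 1) powr (2 * real N - 3 - \<alpha>)" for m
  proof -
    have "((real m + 1) ^ (N - 1))\<^sup>2 = (real m + 1) powr real ((N - 1) * 2)"
      by (subst powr_realpow) (simp, simp only: power_mult)
    then have "((real m + 1) ^ (N - 1))\<^sup>2 * (real m + 1) powr (- \<alpha> - 1)
        = (real m + 1) powr (real ((N - 1) * 2) + (- \<alpha> - 1))"
      by (simp only: powr_add)
    also have "real ((N - 1) * 2) + (- \<alpha> - 1) = 2 * real N - 3 - \<alpha>"
      using N by (simp add: of_nat_diff)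
    finally show ?thesis .
  qed
  show thesis
  proof (rule that[of "c / K\<^sup>2" "C * K\<^sup>2"])
    fix m
    have "c / K\<^sup>2 * (real m + 1) powr (2 * real N - 3 - \<alpha>) = ((real m + 1) ^ (N - 1) / K)\<^sup>2 * (c * (real m + 1) powr (- \<alpha> - 1))"
      unfolding pw[symmetric] by (simp add: power_divide)
    also have "\<dots> \<le> (B m)\<^sup>2 * bergman_weight \<alpha> m"
      using c K lo[of m] by (intro mult_mono power_mono) auto
    finally show "c / K\<^sup>2 * (real m + 1) powr (2 * real N - 3 - \<alpha>) \<le> (real ((m + N - 1) choose (N - 1)))\<^sup>2 * bergman_weight \<alpha> m"
      by (simp add: B_def)
    have "(B m)\<^sup>2 * bergman_weight \<alpha> m \<le> (K * (real m + 1) ^ (N - 1))\<^sup>2 * (C * (real m + 1) powr (- \<alpha> - 1))"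
      using c K up[of m] bergman_weight_pos[OF \<alpha>, of m] by (intro mult_mono power_mono) (auto simp: B_def)
    also have "\<dots> = C * K\<^sup>2 * (real m + 1) powr (2 * real N - 3 - \<alpha>)"
      unfolding pw[symmetric] by (simp add: power_mult_distrib mult_ac)
    finally show "(real ((m + N - 1) choose (N - 1)))\<^sup>2 * bergman_weight \<alpha> m \<le> C * K\<^sup>2 * (real m + 1) powr (2 * real N - 3 - \<alpha>)"
      by (simp add: B_def)
  qed (use c K in auto)
qed

lemma SF_coeff_square_weight:
  "(cmod (SF_coeff N n a m))\<^sup>2 * bergman_weight \<alpha> m
    = (real ((m + N - 1) choose (N - 1)))\<^sup>2 * bergman_weight \<alpha> m * (cmod (power_sum n a (m + N)))\<^sup>2"
  by (simp add: SF_coeff_def norm_mult norm_power power_mult_distrib)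

text \<open>Only the terms with \<open>m < 4 * N * n\<close> are kept. As the exponent e is
  negative, their weights are at least a constant times \<open>n powr e\<close>; the factor
  \<open>n ^ 2\<close> from the tail bound raises the exponent to \<open>e + 2\<close>.\<close>

lemma SF_coeff_sum_lower_bound:
  fixes \<alpha> :: real
  assumes \<alpha>: "\<alpha> > 2 * real N - 3" and N: "N \<ge> 1"
  obtains c where "c > 0"
    "\<And>n a. n \<ge> 1 \<Longrightarrow> (\<And>k. k < n \<Longrightarrow> cmod (a k) = 1) \<Longrightarrow>
       summable (\<lambda>m. (cmod (SF_coeff N n a m))\<^sup>2 * bergman_weight \<alpha> m) \<Longrightarrow>
       c * real n powr (2 * real N - 1 - \<alpha>) \<le> (\<Sum>m. (cmod (SF_coeff N n a m))\<^sup>2 * bergman_weight \<alpha> m)"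
proof -
  have \<alpha>1: "\<alpha> > -1" using \<alpha> N by linarith
  define e where "e = 2 * real N - 3 - \<alpha>"
  have e: "e < 0" using \<alpha> by (simp add: e_def)
  obtain c where c: "c > 0"
    "\<And>m. c * (real m + 1) powr e \<le> (real ((m + N - 1) choose (N - 1)))\<^sup>2 * bergman_weight \<alpha> m"
    using binomial_weight_bounds[OF \<alpha>1 N] unfolding e_def by metis
  define d where "d = c * real N * (4 * real N) powr e"
  have "d > 0" using c N by (simp add: d_def)
  then show thesis
  proof (rule that)
    fix n :: nat and a :: "nat \<Rightarrow> complex"
    assume n: "n \<ge> 1" and a: "\<And>k. k < n \<Longrightarrow> cmod (a k) = 1"
      and s: "summable (\<lambda>m. (cmod (SF_coeff N n a m))\<^sup>2 * bergman_weight \<alpha> m)"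
    let ?L = "4 * N * n"
    have "real n powr (2 * real N - 1 - \<alpha>) = real n powr e * (real n)\<^sup>2"
    proof -
      have "(real n)\<^sup>2 = real n powr 2" using n by (simp add: powr_realpow)
      then show ?thesis by (simp only: powr_add[symmetric]) (simp add: e_def algebra_simps)
    qed
    then have "d * real n powr (2 * real N - 1 - \<alpha>) = c * real ?L powr e * (real N * (real n)\<^sup>2)"
      by (simp add: d_def powr_mult mult_ac)
    also have "\<dots> \<le> c * real ?L powr e * (\<Sum>m<?L. (cmod (power_sum n a (m + N)))\<^sup>2)"
      using c by (intro mult_left_mono power_sum_tail_lower_bound a N n) auto
    also have "\<dots> = (\<Sum>m<?L. c * real ?L powr e * (cmod (power_sum n a (m + N)))\<^sup>2)"
      by (simp add: sum_distrib_left)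
    also have "\<dots> \<le> (\<Sum>m<?L. (cmod (SF_coeff N n a m))\<^sup>2 * bergman_weight \<alpha> m)"
    proof (rule sum_mono)
      fix m assume "m \<in> {..<?L}"
      then have "real m + 1 \<le> real ?L" by (metis lessThan_iff Suc_leI of_nat_Suc of_nat_mono add.commute)
      then have "real ?L powr e \<le> (real m + 1) powr e"
        using e by (intro powr_mono2') auto
      then have "c * real ?L powr e \<le> c * (real m + 1) powr e"
        using c by simp
      also note c(2)[of m]
      finally show "c * real ?L powr e * (cmod (power_sum n a (m + N)))\<^sup>2 \<le> (cmod (SF_coeff N n a m))\<^sup>2 * bergman_weight \<alpha> m"
        unfolding SF_coeff_square_weight by (intro mult_right_mono) auto
    qed
    also have "\<dots> \<le> (\<Sum>m. (cmod (SF_coeff N n a m))\<^sup>2 * bergman_weight \<alpha> m)"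
      by (intro sum_le_suminf s mult_nonneg_nonneg less_imp_le[OF bergman_weight_pos[OF \<alpha>1]]) auto
    finally show "d * real n powr (2 * real N - 1 - \<alpha>) \<le> (\<Sum>m. (cmod (SF_coeff N n a m))\<^sup>2 * bergman_weight \<alpha> m)" .
  qed
qed

section \<open>Failure of density\<close>

lemma bergman_space_iff_summable:
  assumes "\<alpha> > -1" "f \<in> extensional (ball 0 1)"
    and f: "disc_series c f"
  shows "f \<in> bergman_space \<alpha> \<longleftrightarrow> summable (\<lambda>m. (cmod (c m))\<^sup>2 * bergman_weight \<alpha> m)"
proof -
  show ?thesis
    using assms bergman_integrable_iff_summable[OF assms(1) f] disc_series_holomorphic[OF f]
    by (simp add: bergman_space_def)
qed

lemma bergman_space_power_series:
  assumes "f \<in> bergman_space \<alpha>"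
  obtains c where "disc_series c f"
    "\<alpha> > -1 \<Longrightarrow> summable (\<lambda>m. (cmod (c m))\<^sup>2 * bergman_weight \<alpha> m)"
proof -
  define c where "c m = (deriv ^^ m) f 0 / fact m" for m
  have f: "disc_series c f"
    using holomorphic_power_series[of f 0 1] assms by (simp add: bergman_space_def c_def disc_series_def)
  moreover have "summable (\<lambda>m. (cmod (c m))\<^sup>2 * bergman_weight \<alpha> m)" if "\<alpha> > -1"
    using bergman_space_iff_summable[OF that _ f] assms by (simp add: bergman_space_def)
  ultimately show thesis by (rule that)
qed

lemma bergman_diff_integrable:
  assumes "\<alpha> > -1" "f \<in> bergman_space \<alpha>" "g \<in> bergman_space \<alpha>"
  shows "set_integrable area_measure (ball 0 1) (\<lambda>z. (cmod (f z - g z))\<^sup>2 * (1 - (cmod z)\<^sup>2) powr \<alpha>)"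
  using assms weighted_integrable_add(1)[of f "\<lambda>z. - g z" \<alpha>]
  by (auto simp: bergman_space_def intro!: holomorphic_on_minus)

lemma bergman_norm_le_dist:
  assumes \<alpha>: "\<alpha> > -1" and fg: "f \<in> bergman_space \<alpha>" "g \<in> bergman_space \<alpha>"
  shows "bergman_norm \<alpha> f \<le> bergman_norm \<alpha> g + bergman_dist \<alpha> f g"
  using weighted_integrable_add(2)[of g "\<lambda>z. f z - g z" \<alpha>] fg \<alpha> bergman_diff_integrable[OF \<alpha> fg]
  by (simp add: bergman_dist_def bergman_space_def holomorphic_on_diff)

lemma bergman_dist_eq_suminf:
  assumes \<alpha>: "\<alpha> > -1"
    and f: "disc_series c f"
    and g: "disc_series d g"
    and s: "summable (\<lambda>m. (cmod (c m - d m))\<^sup>2 * bergman_weight \<alpha> m)"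
  shows "bergman_dist \<alpha> f g = sqrt ((\<alpha> + 1) * (\<Sum>m. (cmod (c m - d m))\<^sup>2 * bergman_weight \<alpha> m))"
  unfolding bergman_dist_def
  by (rule bergman_norm_eq_suminf[OF \<alpha> disc_series_diff[OF f g] s])

text \<open>A single term of the Parseval series is at most the whole. So each Taylor coefficient is
  continuous, and coefficient bounds survive limits.\<close>

lemma bergman_coeff_le_dist:
  assumes \<alpha>: "\<alpha> > -1"
    and f: "disc_series c f"
    and g: "disc_series d g"
    and fg: "f \<in> bergman_space \<alpha>" "g \<in> bergman_space \<alpha>"
  shows "cmod (c m - d m) * sqrt ((\<alpha> + 1) * bergman_weight \<alpha> m) \<le> bergman_dist \<alpha> f g"
proof -
  let ?b = "\<lambda>m. (cmod (c m - d m))\<^sup>2 * bergman_weight \<alpha> m"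
  have s: "summable ?b"
    using bergman_integrable_iff_summable[OF \<alpha> disc_series_diff[OF f g]] bergman_diff_integrable[OF \<alpha> fg] by simp
  have "?b m \<le> (\<Sum>m. ?b m)"
    using sum_le_suminf[OF s, of "{m}"] bergman_weight_pos[OF \<alpha>] by (simp add: less_imp_le)
  then have "sqrt ((\<alpha> + 1) * ?b m) \<le> bergman_dist \<alpha> f g"
    unfolding bergman_dist_eq_suminf[OF \<alpha> f g s] using \<alpha> by (intro real_sqrt_le_mono mult_left_mono) auto
  then show ?thesis by (simp add: real_sqrt_mult mult_ac)
qed

lemma bergman_closure_iff:
  assumes "\<alpha> > -1"
  shows "f \<in> bergman_topology \<alpha> closure_of S \<longleftrightarrow>
    f \<in> bergman_space \<alpha> \<and> (\<forall>r>0. \<exists>g\<in>S \<inter> bergman_space \<alpha>. bergman_dist \<alpha> f g < r)"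
  using Metric_space.metric_closure_of[OF Metric_space_bergman[OF assms], of S]
    Metric_space.in_mball[OF Metric_space_bergman[OF assms]]
  unfolding bergman_topology_def by auto

lemma bergman_interior_iff:
  assumes "\<alpha> > -1"
  shows "f \<in> bergman_topology \<alpha> interior_of S \<longleftrightarrow>
    f \<in> bergman_space \<alpha> \<and> (\<exists>r>0. \<forall>g\<in>bergman_space \<alpha>. bergman_dist \<alpha> f g < r \<longrightarrow> g \<in> S)"
  using Metric_space.in_interior_of_mball[OF Metric_space_bergman[OF assms], of f S]
    Metric_space.in_mball[OF Metric_space_bergman[OF assms]]
  unfolding bergman_topology_def by (auto simp: subset_iff)

text \<open>If the exponent of n is positive, a bound on the norm bounds the number of poles; if it
  is 0, the norms of members with at least one pole stay away from 0.\<close>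

lemma SF_norm_lower_bound:
  fixes \<alpha> :: real
  assumes \<alpha>: "\<alpha> > 2 * real N - 3" and N: "N \<ge> 1"
  obtains c where "c > 0"
    "\<And>g. g \<in> SF N \<Longrightarrow> g \<in> bergman_space \<alpha> \<Longrightarrow> \<exists>n a. (\<forall>k<n. cmod (a k) = 1) \<and>
       disc_series (SF_coeff N n a) g \<and>
       c * real n powr (2 * real N - 1 - \<alpha>) \<le> (bergman_norm \<alpha> g)\<^sup>2"
proof -
  have \<alpha>1: "\<alpha> > -1" using \<alpha> N by linarith
  obtain c where c: "c > 0"
    "\<And>n a. n \<ge> 1 \<Longrightarrow> (\<And>k. k < n \<Longrightarrow> cmod (a k) = 1) \<Longrightarrow>
       summable (\<lambda>m. (cmod (SF_coeff N n a m))\<^sup>2 * bergman_weight \<alpha> m) \<Longrightarrow>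
       c * real n powr (2 * real N - 1 - \<alpha>) \<le> (\<Sum>m. (cmod (SF_coeff N n a m))\<^sup>2 * bergman_weight \<alpha> m)"
    using SF_coeff_sum_lower_bound[OF \<alpha> N] by blast
  have "(\<alpha> + 1) * c > 0" using c(1) \<alpha>1 by simp
  then show thesis
  proof (rule that)
    fix g assume g: "g \<in> SF N" "g \<in> bergman_space \<alpha>"
    from g(1) obtain n :: nat and a :: "nat \<Rightarrow> complex" where geq: "g = restrict (\<lambda>z. \<Sum>k<n. 1 / (z - a k) ^ N) (ball 0 1)"
      and "\<forall>k<n. a k \<in> sphere 0 1"
      unfolding SF_def by blast
    then have a: "\<forall>k<n. cmod (a k) = 1" by simp
    have sums: "disc_series (SF_coeff N n a) g"
      using SF_sums[of n a N] a N by (simp add: geq disc_series_def)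
    let ?b = "\<lambda>m. (cmod (SF_coeff N n a m))\<^sup>2 * bergman_weight \<alpha> m"
    have s: "summable ?b"
      using bergman_space_iff_summable[OF \<alpha>1 _ sums] g(2) by (simp add: bergman_space_def)
    have "(\<Sum>m. ?b m) \<ge> 0"
      using bergman_weight_pos[OF \<alpha>1] by (intro suminf_nonneg s) (simp add: less_imp_le)
    then have norm: "(bergman_norm \<alpha> g)\<^sup>2 = (\<alpha> + 1) * (\<Sum>m. ?b m)"
      using bergman_norm_eq_suminf[OF \<alpha>1 sums s] \<alpha>1 by simp
    have "(\<alpha> + 1) * c * real n powr (2 * real N - 1 - \<alpha>) \<le> (bergman_norm \<alpha> g)\<^sup>2"
    proof (cases "n \<ge> 1")
      case True
      then show ?thesis
        using c(2)[of n a] a s \<alpha>1 unfolding norm mult.assoc by (intro mult_left_mono) auto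
    next
      \<comment> \<open>Without poles the left side is 0 even for exponent 0, because
        \<open>0 powr 0 = 0\<close>.\<close>
      case False
      then have "n = 0" by simp
      then show ?thesis by simp
    qed
    then show "\<exists>n a. (\<forall>k<n. cmod (a k) = 1) \<and>
       disc_series (SF_coeff N n a) g \<and>
       (\<alpha> + 1) * c * real n powr (2 * real N - 1 - \<alpha>) \<le> (bergman_norm \<alpha> g)\<^sup>2"
      using a sums by blast
  qed
qed

section \<open>Test functions and the two negative results\<close>

text \<open>Supplies the test functions of both negative results: one coefficient is moved, so the
  distance is known exactly and summability is unaffected.\<close>

lemma monomial_perturbation:
  assumes \<alpha>: "\<alpha> > -1" and f: "f \<in> bergman_space \<alpha>"
    and c: "disc_series c f"
    and h_def: "h = restrict (\<lambda>z. f z + of_real t * z ^ m) (ball 0 1)"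
  shows "h \<in> bergman_space \<alpha>"
    and "disc_series (\<lambda>k. (c k + (if k = m then of_real t else 0))) h"
    and "bergman_dist \<alpha> f h = \<bar>t\<bar> * sqrt ((\<alpha> + 1) * bergman_weight \<alpha> m)"
proof -
  show h: "disc_series (\<lambda>k. c k + (if k = m then of_real t else 0)) h"
    unfolding disc_series_def
  proof (intro allI impI)
    fix z :: complex assume z: "cmod z < 1"
    have "(\<lambda>k. c k * z ^ k + (if k = m then of_real t * z ^ k else 0)) sums (f z + of_real t * z ^ m)"
      by (intro sums_add disc_seriesD[OF c z] sums_single)
    also have "(\<lambda>k. c k * z ^ k + (if k = m then of_real t * z ^ k else 0))
        = (\<lambda>k. (c k + (if k = m then of_real t else 0)) * z ^ k)"
      by (auto simp: algebra_simps)
    finally show "(\<lambda>k. (c k + (if k = m then of_real t else 0)) * z ^ k) sums h z"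
      using z by (simp add: h_def)
  qed
  have "summable (\<lambda>k. (cmod (c k))\<^sup>2 * bergman_weight \<alpha> k)"
    using bergman_space_iff_summable[OF \<alpha> _ c] f by (simp add: bergman_space_def)
  then have "summable (\<lambda>k. (cmod (c k + (if k = m then of_real t else 0)))\<^sup>2 * bergman_weight \<alpha> k)"
  proof (rule summable_cong[THEN iffD1, rotated])
    show "\<forall>\<^sub>F k in sequentially. (cmod (c k))\<^sup>2 * bergman_weight \<alpha> k
        = (cmod (c k + (if k = m then of_real t else 0)))\<^sup>2 * bergman_weight \<alpha> k"
      using eventually_gt_at_top[of m] by eventually_elim auto
  qed
  then show "h \<in> bergman_space \<alpha>"
    using bergman_space_iff_summable[OF \<alpha> _ h] by (simp add: h_def)
  have eq: "(\<lambda>k. (cmod (c k - (c k + (if k = m then complex_of_real t else 0))))\<^sup>2 * bergman_weight \<alpha> k)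
      = (\<lambda>k. if k = m then t\<^sup>2 * bergman_weight \<alpha> k else 0)"
    by auto
  have sm: "\<dots> sums (t\<^sup>2 * bergman_weight \<alpha> m)"
    by (rule sums_single)
  have "bergman_dist \<alpha> f h = sqrt ((\<alpha> + 1) * (t\<^sup>2 * bergman_weight \<alpha> m))"
    using bergman_dist_eq_suminf[OF \<alpha> c h] sm unfolding eq by (simp add: sums_iff)
  then show "bergman_dist \<alpha> f h = \<bar>t\<bar> * sqrt ((\<alpha> + 1) * bergman_weight \<alpha> m)"
    by (simp add: real_sqrt_mult mult_ac)
qed

text \<open>If the closure contained a ball, the members of \<open>SF N\<close> approximating its
  points would have boundedly many poles. This bounds the m-th coefficient of every function in the
  ball by an amount that is negligible, in norm units, for large m. Moving that coefficient by half
  the radius stays in the ball but breaks the bound.\<close>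

lemma SF_closure_interior_empty:
  fixes \<alpha> :: real
  assumes N: "N \<ge> 1" and \<alpha>: "2 * real N - 2 < \<alpha>" "\<alpha> < 2 * real N - 1"
  shows "bergman_topology \<alpha> interior_of (bergman_topology \<alpha> closure_of SF N) = {}"
proof (rule ccontr)
  have \<alpha>1: "\<alpha> > -1" using \<alpha> N by linarith
  assume "bergman_topology \<alpha> interior_of (bergman_topology \<alpha> closure_of SF N) \<noteq> {}"
  then obtain f where "f \<in> bergman_topology \<alpha> interior_of (bergman_topology \<alpha> closure_of SF N)"
    by blast
  then obtain r where f: "f \<in> bergman_space \<alpha>" and r: "r > 0"
    and cl: "\<And>h. h \<in> bergman_space \<alpha> \<Longrightarrow> bergman_dist \<alpha> f h < r \<Longrightarrow> h \<in> bergman_topology \<alpha> closure_of SF N"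
    unfolding bergman_interior_iff[OF \<alpha>1] by blast
  obtain c where c: "c > 0" "\<And>g. g \<in> SF N \<Longrightarrow> g \<in> bergman_space \<alpha> \<Longrightarrow> \<exists>n a. (\<forall>k<n. cmod (a k) = 1) \<and>
       disc_series (SF_coeff N n a) g \<and>
       c * real n powr (2 * real N - 1 - \<alpha>) \<le> (bergman_norm \<alpha> g)\<^sup>2"
    using SF_norm_lower_bound[of N \<alpha>] \<alpha> N by auto
  define \<gamma> where "\<gamma> = 2 * real N - 1 - \<alpha>"
  have \<gamma>: "\<gamma> > 0" using \<alpha> by (simp add: \<gamma>_def)
  \<comment> \<open>Bounds the norm of any g within r of some h that is itself within r of
    f.\<close>
  define R where "R = bergman_norm \<alpha> f + 2 * r"
  \<comment> \<open>Solves \<open>c * K powr \<gamma> = R\<^sup>2\<close>; it bounds the number of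
    poles since \<open>\<gamma>\<close> is positive.\<close>
  define K where "K = (R\<^sup>2 / c) powr (1 / \<gamma>)"
  define B where "B m = real ((m + N - 1) choose (N - 1))" for m
  define s where "s m = sqrt ((\<alpha> + 1) * bergman_weight \<alpha> m)" for m
  have s0: "s m > 0" for m using bergman_weight_pos[OF \<alpha>1, of m] \<alpha>1 by (simp add: s_def)
  interpret M: Metric_space "bergman_space \<alpha>" "bergman_dist \<alpha>"
    by (rule Metric_space_bergman[OF \<alpha>1])
  have norm0: "bergman_norm \<alpha> g \<ge> 0" for g
    using \<alpha>1 unfolding bergman_norm_def set_lebesgue_integral_def
    by (intro real_sqrt_ge_zero mult_nonneg_nonneg Bochner_Integration.integral_nonneg) auto
  \<comment> \<open>A coefficient of g is at most \<open>B m * K\<close>, because each power sum is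
    at most the number of poles. The slack \<open>\<eta>\<close> pays for the distance from h to
    g.\<close>
  have bound: "cmod (d m) * s m \<le> K * (B m * s m) + \<eta>"
    if h: "h \<in> bergman_space \<alpha>" "bergman_dist \<alpha> f h < r"
      and d: "disc_series d h" and \<eta>: "\<eta> > 0" "\<eta> \<le> r" for h d m \<eta>
  proof -
    from cl[OF h] \<eta> obtain g where g: "g \<in> SF N" "g \<in> bergman_space \<alpha>" "bergman_dist \<alpha> h g < \<eta>"
      unfolding bergman_closure_iff[OF \<alpha>1] by blast
    then obtain n a where a: "\<forall>k<n. cmod (a k) = 1"
      and ga: "disc_series (SF_coeff N n a) g"
      and lo: "c * real n powr \<gamma> \<le> (bergman_norm \<alpha> g)\<^sup>2"
      using c(2) unfolding \<gamma>_def by blast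
    have "bergman_norm \<alpha> g \<le> bergman_norm \<alpha> f + bergman_dist \<alpha> g f"
      by (rule bergman_norm_le_dist[OF \<alpha>1 g(2) f])
    moreover have "bergman_dist \<alpha> g f \<le> bergman_dist \<alpha> g h + bergman_dist \<alpha> h f"
      by (rule M.triangle[OF g(2) h(1) f])
    ultimately have "bergman_norm \<alpha> g \<le> R"
      using g(3) h(2) \<eta> M.commute[of g h] M.commute[of f h] by (simp add: R_def)
    then have "(bergman_norm \<alpha> g)\<^sup>2 \<le> R\<^sup>2" using norm0[of g] by (intro power_mono)
    then have "real n powr \<gamma> \<le> R\<^sup>2 / c" using lo c(1) by (simp add: field_simps)
    then have "(real n powr \<gamma>) powr (1 / \<gamma>) \<le> K"
      unfolding K_def using \<gamma> by (intro powr_mono2) auto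
    then have nK: "real n \<le> K" using \<gamma> by (simp add: powr_powr)
    have "cmod (SF_coeff N n a m) \<le> B m * K"
      using order_trans[OF cmod_power_sum_le[of n a] nK] a
      by (simp add: SF_coeff_def B_def norm_mult norm_power mult_left_mono)
    moreover have "cmod (d m - SF_coeff N n a m) * s m \<le> \<eta>"
      using bergman_coeff_le_dist[OF \<alpha>1 d ga h(1) g(2), of m] g(3) unfolding s_def by linarith
    moreover have "cmod (d m) \<le> cmod (d m - SF_coeff N n a m) + cmod (SF_coeff N n a m)"
      by (metis diff_add_cancel norm_triangle_ineq)
    then have "cmod (d m) * s m \<le> cmod (d m - SF_coeff N n a m) * s m + cmod (SF_coeff N n a m) * s m"
      using s0[of m] by (simp flip: distrib_right)
    moreover have "cmod (SF_coeff N n a m) * s m \<le> B m * K * s m"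
      using s0[of m] calculation(1) by simp
    ultimately show ?thesis by (simp add: mult_ac)
  qed
  \<comment> \<open>The square of \<open>B m * s m\<close> is of order at most the power
    \<open>2 * N - 3 - \<alpha>\<close> of m + 1, and this exponent is negative.\<close>
  have lim: "(\<lambda>m. K * (B m * s m)) \<longlonglongrightarrow> 0"
  proof -
    obtain C where C: "C > 0"
      "\<And>m. (B m)\<^sup>2 * bergman_weight \<alpha> m \<le> C * (real m + 1) powr (2 * real N - 3 - \<alpha>)"
      using binomial_weight_bounds[OF \<alpha>1 N] unfolding B_def by metis
    have e: "2 * real N - 3 - \<alpha> < 0" using \<alpha> by simp
    have "filterlim (\<lambda>m. real m + 1) at_top sequentially" by real_asymp
    from tendsto_neg_powr[OF e this]
    have "(\<lambda>m. (\<alpha> + 1) * (C * (real m + 1) powr (2 * real N - 3 - \<alpha>))) \<longlonglongrightarrow> (\<alpha> + 1) * (C * 0)"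
      by (intro tendsto_intros)
    then have up: "(\<lambda>m. (\<alpha> + 1) * (C * (real m + 1) powr (2 * real N - 3 - \<alpha>))) \<longlonglongrightarrow> 0"
      by simp
    have "(\<lambda>m. (\<alpha> + 1) * ((B m)\<^sup>2 * bergman_weight \<alpha> m)) \<longlonglongrightarrow> 0"
    proof (rule tendsto_sandwich[OF _ _ tendsto_const up])
      show "\<forall>\<^sub>F m in sequentially. 0 \<le> (\<alpha> + 1) * ((B m)\<^sup>2 * bergman_weight \<alpha> m)"
        using bergman_weight_pos[OF \<alpha>1] \<alpha>1 by (simp add: less_imp_le)
      show "\<forall>\<^sub>F m in sequentially. (\<alpha> + 1) * ((B m)\<^sup>2 * bergman_weight \<alpha> m)
          \<le> (\<alpha> + 1) * (C * (real m + 1) powr (2 * real N - 3 - \<alpha>))"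
        using C(2) \<alpha>1 by simp
    qed
    then have "(\<lambda>m. sqrt ((\<alpha> + 1) * ((B m)\<^sup>2 * bergman_weight \<alpha> m))) \<longlonglongrightarrow> sqrt 0"
      by (intro tendsto_intros)
    also have "(\<lambda>m. sqrt ((\<alpha> + 1) * ((B m)\<^sup>2 * bergman_weight \<alpha> m))) = (\<lambda>m. B m * s m)"
      by (simp add: s_def B_def real_sqrt_mult mult_ac)
    finally show ?thesis using tendsto_mult_left[of "\<lambda>m. B m * s m" 0 sequentially K] by simp
  qed
  \<comment> \<open>With slack \<open>r / 16\<close> too, the scaled m-th coefficients of f and of
    its perturbation are each below \<open>r / 8\<close>, so they cannot differ by
    \<open>r / 2\<close>.\<close>
  have "\<forall>\<^sub>F m in sequentially. K * (B m * s m) < r / 16"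
    using order_tendstoD(2)[OF lim, of "r / 16"] r by simp
  then obtain m where m: "K * (B m * s m) < r / 16"
    by (auto simp: eventually_sequentially)
  obtain fc where fc: "disc_series fc f"
    using bergman_space_power_series[OF f] by blast
  \<comment> \<open>Makes the added monomial have norm \<open>r / 2\<close>, so the perturbed
    function stays inside the ball.\<close>
  define t where "t = r / 2 / s m"
  define h where "h = restrict (\<lambda>z. f z + of_real t * z ^ m) (ball 0 1)"
  note mp = monomial_perturbation[OF \<alpha>1 f fc h_def]
  have ts: "t * s m = r / 2" "t > 0" using s0[of m] r by (simp_all add: t_def)
  have dh: "bergman_dist \<alpha> f h < r"
    using mp(3) ts r by (simp flip: s_def)
  have 1: "cmod (fc m) * s m \<le> K * (B m * s m) + r / 16"
    by (rule bound[OF f _ fc]) (use r M.mdist_zero[OF f] in auto)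
  have 2: "cmod (fc m + of_real t) * s m \<le> K * (B m * s m) + r / 16"
    using bound[OF mp(1) dh mp(2), of "r / 16" m] r by simp
  have "t = cmod (of_real t)" using ts by simp
  also have "\<dots> \<le> cmod (fc m + of_real t) + cmod (fc m)"
    by (metis add_diff_cancel_left' norm_triangle_ineq4)
  finally have "t * s m \<le> cmod (fc m + of_real t) * s m + cmod (fc m) * s m"
    using s0[of m] by (simp flip: distrib_right)
  then show False using 1 2 m ts r by linarith
qed

text \<open>Here the exponent of n vanishes, so every member with at least one pole has norm at
  least \<open>sqrt c\<close>. A constant of norm \<open>sqrt c / 2\<close> is then at distance at
  least \<open>sqrt c / 2\<close> from those members and from the zero function alike.\<close>

lemma SF_not_dense:
  fixes \<alpha> :: real
  assumes N: "N \<ge> 1" and \<alpha>: "\<alpha> = 2 * real N - 1"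
  shows "bergman_topology \<alpha> closure_of SF N \<noteq> bergman_space \<alpha>"
proof
  have \<alpha>1: "\<alpha> > -1" using \<alpha> N by linarith
  assume cl: "bergman_topology \<alpha> closure_of SF N = bergman_space \<alpha>"
  obtain c where c: "c > 0" "\<And>g. g \<in> SF N \<Longrightarrow> g \<in> bergman_space \<alpha> \<Longrightarrow> \<exists>n a. (\<forall>k<n. cmod (a k) = 1) \<and>
       disc_series (SF_coeff N n a) g \<and>
       c * real n powr (2 * real N - 1 - \<alpha>) \<le> (bergman_norm \<alpha> g)\<^sup>2"
    using SF_norm_lower_bound[of N \<alpha>] \<alpha> N by auto
  interpret M: Metric_space "bergman_space \<alpha>" "bergman_dist \<alpha>"
    by (rule Metric_space_bergman[OF \<alpha>1])
  \<comment> \<open>The zero vector of the space, cut off to be \<open>undefined\<close> outside the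
    disc.\<close>
  define o' where "o' = restrict (\<lambda>z :: complex. 0 :: complex) (ball 0 1)"
  have o1: "disc_series (\<lambda>m. 0) o'"
    by (simp add: o'_def disc_series_def)
  have o2: "o' \<in> bergman_space \<alpha>"
    using bergman_space_iff_summable[OF \<alpha>1 _ o1] by (simp add: o'_def)
  define s where "s = sqrt ((\<alpha> + 1) * bergman_weight \<alpha> 0)"
  have s: "s > 0" using bergman_weight_pos[OF \<alpha>1, of 0] \<alpha>1 by (simp add: s_def)
  \<comment> \<open>Gives the constant function with value t the norm
    \<open>sqrt c / 2\<close>.\<close>
  define t where "t = sqrt c / 2 / s"
  define h where "h = restrict (\<lambda>z. o' z + of_real t * z ^ 0) (ball 0 1)"
  note mp = monomial_perturbation[OF \<alpha>1 o2 o1 h_def]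
  have d: "bergman_dist \<alpha> o' h = sqrt c / 2"
    using mp(3) s c(1) by (simp add: t_def s_def[symmetric])
  have "\<exists>g\<in>SF N \<inter> bergman_space \<alpha>. bergman_dist \<alpha> h g < sqrt c / 2"
  proof -
    have "h \<in> bergman_topology \<alpha> closure_of SF N" using mp(1) cl by blast
    moreover have "sqrt c / 2 > 0" using c(1) by simp
    ultimately show ?thesis unfolding bergman_closure_iff[OF \<alpha>1] by blast
  qed
  then obtain g where g: "g \<in> SF N" "g \<in> bergman_space \<alpha>" "bergman_dist \<alpha> h g < sqrt c / 2"
    by blast
  then obtain n a where a: "\<forall>k<n. cmod (a k) = 1"
    and ga: "disc_series (SF_coeff N n a) g"
    and lo: "c * real n powr (2 * real N - 1 - \<alpha>) \<le> (bergman_norm \<alpha> g)\<^sup>2"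
    using c(2) by blast
  show False
  proof (cases "n = 0")
    \<comment> \<open>No poles: g is the zero function, at distance exactly
      \<open>sqrt c / 2\<close> from h, which contradicts the strict inequality.\<close>
    case True
    have "g z = o' z" for z
    proof (cases "cmod z < 1")
      case True
      then have "(\<lambda>m. 0) sums g z" using disc_seriesD[OF ga, of z] \<open>n = 0\<close> by (simp add: SF_coeff_def power_sum_def)
      then have "g z = 0" using sums_unique2 sums_zero by blast
      then show ?thesis using True by (simp add: o'_def)
    next
      case False
      then show ?thesis using g(2) by (simp add: bergman_space_def o'_def extensional_def)
    qed
    then have "g = o'" by blast
    then show False using g(3) d M.commute[of h o'] by simp
  next
    case False
    have "bergman_norm \<alpha> o' = 0"
      using bergman_norm_eq_suminf[OF \<alpha>1 o1] by simp
    then have "bergman_norm \<alpha> g \<le> bergman_dist \<alpha> g o'"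
      using bergman_norm_le_dist[OF \<alpha>1 g(2) o2] by simp
    also have "\<dots> \<le> bergman_dist \<alpha> g h + bergman_dist \<alpha> h o'"
      by (rule M.triangle[OF g(2) mp(1) o2])
    also have "\<dots> < sqrt c"
      using g(3) d M.commute[of g h] M.commute[of h o'] by simp
    finally have "(bergman_norm \<alpha> g)\<^sup>2 < (sqrt c)\<^sup>2"
      using \<alpha>1 unfolding bergman_norm_def set_lebesgue_integral_def
      by (intro power_strict_mono real_sqrt_ge_zero mult_nonneg_nonneg Bochner_Integration.integral_nonneg) auto
    moreover have "c \<le> (bergman_norm \<alpha> g)\<^sup>2"
      using lo False unfolding \<alpha> by simp
    ultimately show False using c(1) by simp
  qed
qed

section \<open>Density\<close>

lemma norm_cis_approx:
  shows "cmod (cis x - 1) \<le> \<bar>x\<bar>" and "cmod (cis x - 1 - \<i> * of_real x) \<le> x\<^sup>2 / 2"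
  using iexp_approx1[of x 0] iexp_approx1[of x 1]
  by (simp_all add: cis_conv_exp numeral_2_eq_2 algebra_simps)

definition perturbed_root :: "(real \<Rightarrow> real) \<Rightarrow> nat \<Rightarrow> nat \<Rightarrow> complex" where
  "perturbed_root u n k = cis (2 * pi * real k / real n + u (2 * pi * real k / real n) / real n)"

lemma norm_perturbed_root: "cmod (perturbed_root u n k) = 1"
  by (simp add: perturbed_root_def)

lemma cnj_perturbed_root_power:
  "cnj (perturbed_root u n k) ^ J
    = cis (2 * pi * real k * of_int (- int J) / real n) * cis (- (real J * u (2 * pi * real k / real n) / real n))"
  by (simp add: perturbed_root_def cis_cnj Complex.DeMoivre cis_mult algebra_simps)

text \<open>The unperturbed power sum is 0 unless n divides J, and then it is n, hence at most J.
  The perturbation changes each of the n terms by at most \<open>J * s / n\<close>. The resulting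
  bound does not depend on n.\<close>

lemma norm_power_sum_perturbed_root_le:
  assumes u: "\<And>\<tau>. \<bar>u \<tau>\<bar> \<le> s" and J: "J \<ge> 1"
  shows "cmod (power_sum n (perturbed_root u n) J) \<le> real J * (1 + s)"
proof (cases "n = 0")
  case True
  then show ?thesis using u[of 0] by (simp add: power_sum_def)
next
  case False
  define E where "E k = cis (2 * pi * real k * of_int (- int J) / real n)" for k
  define x where "x k = - (real J * u (2 * pi * real k / real n) / real n)" for k
  have x: "\<bar>x k\<bar> \<le> real J * s / real n" for k
    unfolding x_def using u by (simp add: abs_mult divide_right_mono mult_left_mono)
  have "power_sum n (perturbed_root u n) J = (\<Sum>k<n. E k) + (\<Sum>k<n. E k * (cis (x k) - 1))"
    by (simp add: power_sum_def cnj_perturbed_root_power E_def x_def algebra_simps flip: sum.distrib)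
  also have "cmod \<dots> \<le> cmod (\<Sum>k<n. E k) + cmod (\<Sum>k<n. E k * (cis (x k) - 1))"
    by (rule norm_triangle_ineq)
  also have "cmod (\<Sum>k<n. E k) \<le> real J"
  proof -
    have "(\<Sum>k<n. E k) = (if int n dvd - int J then of_nat n else 0)"
      unfolding E_def using False by (intro sum_cis_roots) simp
    then show ?thesis using J by (auto dest: dvd_imp_le)
  qed
  also have "cmod (\<Sum>k<n. E k * (cis (x k) - 1)) \<le> (\<Sum>k<n. real J * s / real n)"
    using norm_cis_approx(1)[of "x _"] x
    by (intro sum_norm_le) (auto simp: norm_mult E_def intro: order_trans)
  also have "\<dots> = real J * s" using False by simp
  finally show ?thesis by (simp add: algebra_simps)
qed

text \<open>Expand the perturbation to first order. The constant term vanishes by orthogonality, the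
  linear term extracts the J-th Fourier coefficient \<open>b J / 2\<close> of u, and the n quadratic
  remainders of order \<open>1 / n ^ 2\<close> sum up to order \<open>1 / n\<close>.\<close>

lemma power_sum_perturbed_root_tendsto:
  fixes b :: "nat \<Rightarrow> complex"
  assumes b: "\<And>j. j \<ge> B \<Longrightarrow> b j = 0" and J: "J \<ge> 1"
  defines "u \<equiv> \<lambda>\<tau>. Re (\<Sum>j<B. b j * cis (real j * \<tau>))"
  shows "(\<lambda>n. power_sum n (perturbed_root u n) J) \<longlonglongrightarrow> - \<i> * of_nat J * b J / 2"
proof -
  define s where "s = (\<Sum>j<B. cmod (b j))"
  have s0: "s \<ge> 0" by (simp add: s_def sum_nonneg)
  have u: "\<bar>u \<tau>\<bar> \<le> s" for \<tau>
  proof -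
    have "\<bar>u \<tau>\<bar> \<le> cmod (\<Sum>j<B. b j * cis (real j * \<tau>))"
      unfolding u_def by (rule abs_Re_le_cmod)
    also have "\<dots> \<le> s" unfolding s_def by (intro sum_norm_le) (simp add: norm_mult)
    finally show ?thesis .
  qed
  \<comment> \<open>For \<open>n > J + B\<close> all frequencies involved are smaller than n in
    absolute value, so sampling at n points causes no aliasing.\<close>
  have main: "cmod (power_sum n (perturbed_root u n) J - (- \<i> * of_nat J * b J / 2)) \<le> (real J)\<^sup>2 * s\<^sup>2 / 2 / real n"
    if n: "n > J + B" for n
  proof -
    have n0: "n > 0" using n by simp
    define \<tau> where "\<tau> k = 2 * pi * real k / real n" for k
    define E where "E i k = cis (2 * pi * real k * of_int i / real n)" for i k
    have sumE: "(\<Sum>k<n. E i k) = (if int n dvd i then of_nat n else 0)" for i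
      unfolding E_def by (rule sum_cis_roots[OF n0])
    define x where "x k = - (real J * u (\<tau> k) / real n)" for k
    have x: "(x k)\<^sup>2 \<le> (real J * s / real n)\<^sup>2" for k
      unfolding x_def using u s0
      by (simp add: power_divide power_mult_distrib divide_right_mono mult_left_mono abs_le_square_iff[symmetric])
    have ps: "power_sum n (perturbed_root u n) J
        = (\<Sum>k<n. E (- int J) k) + (\<Sum>k<n. E (- int J) k * (\<i> * of_real (x k)))
          + (\<Sum>k<n. E (- int J) k * (cis (x k) - 1 - \<i> * of_real (x k)))"
      by (simp add: power_sum_def cnj_perturbed_root_power E_def x_def \<tau>_def algebra_simps flip: sum.distrib)
    have first: "(\<Sum>k<n. E (- int J) k) = 0"
      unfolding sumE using n J by (auto dest: dvd_imp_le)
    \<comment> \<open>The real part splits u into frequencies j and -j; only the former can cancel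
      the frequency -J.\<close>
    have ucomplex: "complex_of_real (u (\<tau> k)) = (\<Sum>j<B. (b j * E (int j) k + cnj (b j) * E (- int j) k) / 2)" for k
    proof -
      have "complex_of_real (u (\<tau> k)) = (\<Sum>j<B. complex_of_real (Re (b j * E (int j) k)))"
        by (simp add: u_def E_def \<tau>_def mult_ac del: Re_complex_of_real times_complex.sel)
      also have "\<dots> = (\<Sum>j<B. (b j * E (int j) k + cnj (b j) * E (- int j) k) / 2)"
      proof (intro sum.cong refl)
        fix j
        have "E (- int j) k = cnj (E (int j) k)" by (simp add: E_def cis_cnj)
        then show "complex_of_real (Re (b j * E (int j) k)) = (b j * E (int j) k + cnj (b j) * E (- int j) k) / 2"
          using complex_add_cnj[of "b j * E (int j) k"] by simp
      qed
      finally show ?thesis .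
    qed
    have EE: "E i k * E l k = E (i + l) k" for i l k
      by (simp add: E_def cis_mult add_divide_distrib distrib_left)
    have "(\<Sum>k<n. E (- int J) k * of_real (u (\<tau> k)))
        = (\<Sum>k<n. \<Sum>j<B. (b j * E (int j - int J) k + cnj (b j) * E (- int j - int J) k) / 2)"
      unfolding ucomplex sum_distrib_left
    proof (intro sum.cong refl)
      fix j k
      show "E (- int J) k * ((b j * E (int j) k + cnj (b j) * E (- int j) k) / 2)
          = (b j * E (int j - int J) k + cnj (b j) * E (- int j - int J) k) / 2"
      proof -
        have "E (- int J) k * E (int j) k = E (int j - int J) k"
          "E (- int J) k * E (- int j) k = E (- int j - int J) k"
          unfolding EE by (rule arg_cong[where f = "\<lambda>i. E i k"], simp)+
        then show ?thesis
          by (simp add: distrib_left mult.left_commute[of "E (- int J) k"])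
      qed
    qed
    also have "\<dots> = (\<Sum>j<B. (b j * (\<Sum>k<n. E (int j - int J) k) + cnj (b j) * (\<Sum>k<n. E (- int j - int J) k)) / 2)"
      by (subst sum.swap) (simp add: sum_distrib_left sum.distrib flip: sum_divide_distrib)
    also have "\<dots> = (\<Sum>j<B. if j = J then of_nat n * b J / 2 else 0)"
    proof (intro sum.cong refl)
      fix j assume j: "j \<in> {..<B}"
      have "int n dvd int j - int J \<longleftrightarrow> j = J"
      proof
        assume d: "int n dvd int j - int J"
        show "j = J"
        proof (rule ccontr)
          assume "j \<noteq> J"
          then have "int n \<le> \<bar>int j - int J\<bar>"
            using d by (intro zdvd_imp_le) auto
          then show False using n j by auto
        qed
      qed simp
      \<comment> \<open>Here \<open>J \<ge> 1\<close> matters: \<open>j + J\<close> is positive and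
        smaller than n.\<close>
      moreover have "\<not> int n dvd - int j - int J"
      proof
        assume "int n dvd - int j - int J"
        then have "int n dvd int j + int J" by (metis dvd_minus_iff minus_diff_eq diff_minus_eq_add add.commute minus_add_distrib)
        then have "int n \<le> int j + int J" using J by (intro zdvd_imp_le) auto
        then show False using n j by auto
      qed
      ultimately show "(b j * (\<Sum>k<n. E (int j - int J) k) + cnj (b j) * (\<Sum>k<n. E (- int j - int J) k)) / 2
          = (if j = J then of_nat n * b J / 2 else 0)"
        unfolding sumE by simp
    qed
    also have "\<dots> = of_nat n * b J / 2"
      using b[of J] by (cases "J < B") auto
    finally have av: "(\<Sum>k<n. E (- int J) k * of_real (u (\<tau> k))) = of_nat n * b J / 2" .
    have "(\<Sum>k<n. E (- int J) k * (\<i> * of_real (x k)))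
        = (- \<i> * of_nat J / of_nat n) * (\<Sum>k<n. E (- int J) k * of_real (u (\<tau> k)))"
      unfolding sum_distrib_left by (intro sum.cong refl) (simp add: x_def)
    also have "\<dots> = - \<i> * of_nat J * b J / 2"
      unfolding av using n0 by simp
    finally have "power_sum n (perturbed_root u n) J - (- \<i> * of_nat J * b J / 2)
        = (\<Sum>k<n. E (- int J) k * (cis (x k) - 1 - \<i> * of_real (x k)))"
      unfolding ps first by simp
    also have "cmod \<dots> \<le> (\<Sum>k<n. (real J * s / real n)\<^sup>2 / 2)"
    proof (rule sum_norm_le)
      fix k
      show "cmod (E (- int J) k * (cis (x k) - 1 - \<i> * of_real (x k))) \<le> (real J * s / real n)\<^sup>2 / 2"
        using norm_cis_approx(2)[of "x k"] x[of k] by (simp add: norm_mult E_def)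
    qed
    also have "\<dots> = (real J)\<^sup>2 * s\<^sup>2 / 2 / real n"
      using n0 by (simp add: power2_eq_square field_simps)
    finally show ?thesis .
  qed
  have "(\<lambda>n. power_sum n (perturbed_root u n) J - (- \<i> * of_nat J * b J / 2)) \<longlonglongrightarrow> 0"
  proof (rule Lim_null_comparison)
    show "\<forall>\<^sub>F n in sequentially. cmod (power_sum n (perturbed_root u n) J - (- \<i> * of_nat J * b J / 2))
        \<le> (real J)\<^sup>2 * s\<^sup>2 / 2 / real n"
      using eventually_gt_at_top[of "J + B"] by eventually_elim (rule main)
    show "(\<lambda>n. (real J)\<^sup>2 * s\<^sup>2 / 2 / real n) \<longlonglongrightarrow> 0"
      by (rule lim_const_over_n)
  qed
  then show ?thesis by (rule LIM_zero_cancel)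
qed

section \<open>Approximation in norm and density\<close>

lemma cmod_diff_square_le: "(cmod (x - y))\<^sup>2 \<le> 2 * (cmod x)\<^sup>2 + 2 * (cmod y)\<^sup>2"
proof -
  have "(cmod (x - y))\<^sup>2 \<le> (cmod x + cmod y)\<^sup>2"
    by (intro power_mono norm_triangle_ineq4) simp
  also have "\<dots> \<le> 2 * (cmod x)\<^sup>2 + 2 * (cmod y)\<^sup>2"
    using sum_squares_bound[of "cmod x" "cmod y"] by (simp add: power2_sum)
  finally show ?thesis .
qed

text \<open>Each coefficient converges by \<open>power_sum_perturbed_root_tendsto\<close>, and the
  bound on power sums uniform in n provides a summable majorant. Dominated convergence for series
  then gives convergence in norm.\<close>

lemma SF_approximates_polynomial:
  fixes \<alpha> :: real and d :: "nat \<Rightarrow> complex"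
  assumes N: "N \<ge> 1" and \<alpha>: "\<alpha> > 2 * real N" and d: "\<forall>m\<ge>M. d m = 0" and \<epsilon>: "\<epsilon> > 0"
  obtains n a where "\<And>k. cmod (a k) = 1"
    "summable (\<lambda>m. (cmod (SF_coeff N n a m))\<^sup>2 * bergman_weight \<alpha> m)"
    "summable (\<lambda>m. (cmod (d m - SF_coeff N n a m))\<^sup>2 * bergman_weight \<alpha> m)"
    "(\<Sum>m. (cmod (d m - SF_coeff N n a m))\<^sup>2 * bergman_weight \<alpha> m) < \<epsilon>"
proof -
  have \<alpha>1: "\<alpha> > -1" using \<alpha> N by linarith
  define A where "A m = real ((m + N - 1) choose (N - 1))" for m
  have A: "A m > 0" for m using N by (simp add: A_def)
  \<comment> \<open>chosen so that \<open>(-1) ^ N * A m * (- \<i> * (m + N) * b (m + N) / 2) = d m\<close>\<close>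
  define b where "b j = (if j < N then 0 else 2 * \<i> * (-1) ^ N * d (j - N) / of_real (A (j - N) * real j))" for j
  have b0: "b j = 0" if "j \<ge> N + M" for j using that d by (simp add: b_def)
  define u where "u \<tau> = Re (\<Sum>j<N + M. b j * cis (real j * \<tau>))" for \<tau>
  define s where "s = (\<Sum>j<N + M. cmod (b j))"
  have u: "\<bar>u \<tau>\<bar> \<le> s" for \<tau>
  proof -
    have "\<bar>u \<tau>\<bar> \<le> cmod (\<Sum>j<N + M. b j * cis (real j * \<tau>))"
      unfolding u_def by (rule abs_Re_le_cmod)
    also have "\<dots> \<le> s" unfolding s_def by (intro sum_norm_le) (simp add: norm_mult)
    finally show ?thesis .
  qed
  define g where "g n = SF_coeff N n (perturbed_root u n)" for n
  define w where "w m = (1 + s)\<^sup>2 * (real (m + N))\<^sup>2 * ((A m)\<^sup>2 * bergman_weight \<alpha> m)" for m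
  have w0: "bergman_weight \<alpha> m \<ge> 0" for m using bergman_weight_pos[OF \<alpha>1, of m] by simp
  have gw: "(cmod (g n m))\<^sup>2 * bergman_weight \<alpha> m \<le> w m" for n m
  proof -
    have "cmod (power_sum n (perturbed_root u n) (m + N)) \<le> real (m + N) * (1 + s)"
      using N by (intro norm_power_sum_perturbed_root_le u) simp
    then have "(cmod (power_sum n (perturbed_root u n) (m + N)))\<^sup>2 \<le> (real (m + N) * (1 + s))\<^sup>2"
      by (intro power_mono) auto
    then have "(A m)\<^sup>2 * bergman_weight \<alpha> m * (cmod (power_sum n (perturbed_root u n) (m + N)))\<^sup>2
        \<le> (A m)\<^sup>2 * bergman_weight \<alpha> m * (real (m + N) * (1 + s))\<^sup>2"
      using w0 by (intro mult_left_mono) auto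
    then show ?thesis
      unfolding g_def SF_coeff_square_weight w_def A_def[symmetric] by (simp add: power_mult_distrib mult_ac)
  qed
  \<comment> \<open>The power sum bound contributes two to the exponent of m + 1. The total
    \<open>2 * N - 1 - \<alpha>\<close> is below -1 exactly when
    \<open>\<alpha> > 2 * N\<close>.\<close>
  have sw: "summable w"
  proof -
    obtain C where C: "C > 0"
      "\<And>m. (A m)\<^sup>2 * bergman_weight \<alpha> m \<le> C * (real m + 1) powr (2 * real N - 3 - \<alpha>)"
      using binomial_weight_bounds[OF \<alpha>1 N] unfolding A_def by metis
    have "summable (\<lambda>m. real (m + 1) powr (2 * real N - 1 - \<alpha>))"
      using \<alpha> by (subst summable_iff_shift[of "\<lambda>m. real m powr (2 * real N - 1 - \<alpha>)" 1])
        (simp add: summable_real_powr_iff)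
    then have "summable (\<lambda>m. (1 + s)\<^sup>2 * (real N)\<^sup>2 * C * real (m + 1) powr (2 * real N - 1 - \<alpha>))"
      by (rule summable_mult)
    then show ?thesis
    proof (rule summable_comparison_test'[of _ 0])
      fix m
      have "real (m + N) \<le> real (N * (m + 1))" using N by (intro of_nat_mono) (cases N, auto)
      then have "real (m + N) \<le> real N * (real m + 1)" by (simp add: algebra_simps)
      then have 1: "(real (m + N))\<^sup>2 \<le> (real N * (real m + 1))\<^sup>2" by (intro power_mono) auto
      have "w m \<le> (1 + s)\<^sup>2 * (real N * (real m + 1))\<^sup>2 * (C * (real m + 1) powr (2 * real N - 3 - \<alpha>))"
        unfolding w_def by (intro mult_mono mult_left_mono 1 C(2)) (use w0 in auto)
      also have "\<dots> = (1 + s)\<^sup>2 * (real N)\<^sup>2 * C * ((real m + 1)\<^sup>2 * (real m + 1) powr (2 * real N - 3 - \<alpha>))"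
        by (simp add: power_mult_distrib)
      also have "(real m + 1)\<^sup>2 = (real m + 1) powr 2" by (simp add: powr_realpow)
      also have "(real m + 1) powr 2 * (real m + 1) powr (2 * real N - 3 - \<alpha>) = real (m + 1) powr (2 * real N - 1 - \<alpha>)"
        unfolding powr_add[symmetric] by (rule arg_cong2[where f = "(powr)"]) simp_all
      finally have "w m \<le> (1 + s)\<^sup>2 * (real N)\<^sup>2 * C * real (m + 1) powr (2 * real N - 1 - \<alpha>)" .
      moreover have "w m \<ge> 0" using w0 by (simp add: w_def)
      ultimately show "norm (w m) \<le> (1 + s)\<^sup>2 * (real N)\<^sup>2 * C * real (m + 1) powr (2 * real N - 1 - \<alpha>)"
        by simp
    qed
  qed
  have sg: "summable (\<lambda>m. (cmod (g n m))\<^sup>2 * bergman_weight \<alpha> m)" for n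
    using w0 by (intro summable_comparison_test'[OF sw, of 0]) (simp add: gw)
  have sd: "summable (\<lambda>m. (cmod (d m))\<^sup>2 * bergman_weight \<alpha> m)"
    by (rule summable_finite[of "{..<M}"]) (use d in auto)
  define h where "h m n = (cmod (d m - g n m))\<^sup>2 * bergman_weight \<alpha> m" for m n
  have h0: "h m n \<ge> 0" for m n using w0 by (simp add: h_def)
  have hb: "norm (h m n) \<le> 2 * ((cmod (d m))\<^sup>2 * bergman_weight \<alpha> m) + 2 * w m" for m n
  proof -
    have "h m n \<le> (2 * (cmod (d m))\<^sup>2 + 2 * (cmod (g n m))\<^sup>2) * bergman_weight \<alpha> m"
      unfolding h_def by (intro mult_right_mono cmod_diff_square_le w0)
    then show ?thesis using gw[of n m] h0[of m n] by (simp add: algebra_simps)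
  qed
  have sb: "summable (\<lambda>m. 2 * ((cmod (d m))\<^sup>2 * bergman_weight \<alpha> m) + 2 * w m)"
    by (intro summable_add summable_mult sd sw)
  have lim: "(\<lambda>n. h m n) \<longlonglongrightarrow> 0" for m
  proof -
    have "(\<lambda>n. g n m) \<longlonglongrightarrow> (-1) ^ N * of_nat ((m + N - 1) choose (N - 1)) * (- \<i> * of_nat (m + N) * b (m + N) / 2)"
      unfolding g_def SF_coeff_def u_def
      using N by (intro tendsto_intros power_sum_perturbed_root_tendsto b0) auto
    also have "(-1) ^ N * of_nat ((m + N - 1) choose (N - 1)) * (- \<i> * of_nat (m + N) * b (m + N) / 2) = d m"
    proof -
      define e x y where "e = (-1 :: complex) ^ N" and "x = complex_of_real (A m)"
        and "y = (of_nat (m + N) :: complex)"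
      have nz: "x \<noteq> 0" "y \<noteq> 0" using A[of m] N by (auto simp: x_def y_def simp del: of_nat_add)
      \<comment> \<open>The sign in b and the sign in the Taylor coefficient cancel.\<close>
      have "e * e = 1" unfolding e_def by (simp flip: power_mult_distrib)
      have "b (m + N) = 2 * \<i> * e * d m / (x * y)"
        by (simp add: b_def e_def x_def y_def)
      then have "e * x * (- \<i> * y * b (m + N) / 2) = (e * e) * d m"
        using nz by (simp add: field_simps)
      then show ?thesis
        using \<open>e * e = 1\<close> by (simp add: e_def x_def y_def A_def)
    qed
    finally have "(\<lambda>n. (cmod (d m - g n m))\<^sup>2 * bergman_weight \<alpha> m) \<longlonglongrightarrow> (cmod (d m - d m))\<^sup>2 * bergman_weight \<alpha> m"
      by (intro tendsto_intros)
    then show ?thesis by (simp add: h_def)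
  qed
  have "(\<lambda>n. \<Sum>m. h m n) \<longlonglongrightarrow> (\<Sum>m. 0)"
    using tannerys_theorem[of h "\<lambda>_. 0" sequentially, OF lim _ sb] hb by (simp add: always_eventually)
  then have "\<forall>\<^sub>F n in sequentially. (\<Sum>m. h m n) < \<epsilon>"
    using \<epsilon> by (intro order_tendstoD(2)) simp
  then obtain n where n: "(\<Sum>m. h m n) < \<epsilon>" by (auto simp: eventually_sequentially)
  show thesis
  proof (rule that[of "perturbed_root u n" n])
    show "summable (\<lambda>m. (cmod (SF_coeff N n (perturbed_root u n) m))\<^sup>2 * bergman_weight \<alpha> m)"
      using sg[of n] by (simp add: g_def)
    have "summable (\<lambda>m. h m n)"
      by (rule summable_comparison_test'[OF sb, of 0]) (rule hb)
    then show "summable (\<lambda>m. (cmod (d m - SF_coeff N n (perturbed_root u n) m))\<^sup>2 * bergman_weight \<alpha> m)"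
      by (simp add: g_def h_def)
    show "(\<Sum>m. (cmod (d m - SF_coeff N n (perturbed_root u n) m))\<^sup>2 * bergman_weight \<alpha> m) < \<epsilon>"
      using n by (simp add: g_def h_def)
  qed (rule norm_perturbed_root)
qed

text \<open>Truncate the Taylor series of f to a polynomial, approximate that polynomial by a member
  of \<open>SF N\<close>, and add the two errors.\<close>

lemma SF_dense:
  fixes \<alpha> :: real
  assumes N: "N \<ge> 1" and \<alpha>: "\<alpha> > 2 * real N"
  shows "bergman_topology \<alpha> closure_of SF N = bergman_space \<alpha>"
proof -
  have \<alpha>1: "\<alpha> > -1" using \<alpha> N by linarith
  have w0: "bergman_weight \<alpha> m \<ge> 0" for m using bergman_weight_pos[OF \<alpha>1, of m] by simp
  have "\<exists>g\<in>SF N \<inter> bergman_space \<alpha>. bergman_dist \<alpha> f g < r" if f: "f \<in> bergman_space \<alpha>" and r: "r > 0" for f r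
  proof -
    obtain c where c: "disc_series c f" and sc: "summable (\<lambda>m. (cmod (c m))\<^sup>2 * bergman_weight \<alpha> m)"
      using bergman_space_power_series[OF f] \<alpha>1 by blast
    \<comment> \<open>The squared distance carries the factor \<open>\<alpha> + 1\<close>, and the
      two errors, each below \<open>\<epsilon>\<close>, enter with factor 2.\<close>
    define \<epsilon> where "\<epsilon> = r\<^sup>2 / (\<alpha> + 1) / 4"
    have \<epsilon>: "\<epsilon> > 0" using r \<alpha>1 by (simp add: \<epsilon>_def)
    obtain M where M: "norm (\<Sum>m. (cmod (c (m + M)))\<^sup>2 * bergman_weight \<alpha> (m + M)) < \<epsilon>"
      using suminf_exist_split[OF \<epsilon> sc] by blast
    define d where "d m = (if m < M then c m else 0)" for m
    obtain n :: nat and a :: "nat \<Rightarrow> complex" where a: "\<And>k. cmod (a k) = 1"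
      and sg: "summable (\<lambda>m. (cmod (SF_coeff N n a m))\<^sup>2 * bergman_weight \<alpha> m)"
      and sh: "summable (\<lambda>m. (cmod (d m - SF_coeff N n a m))\<^sup>2 * bergman_weight \<alpha> m)"
      and h: "(\<Sum>m. (cmod (d m - SF_coeff N n a m))\<^sup>2 * bergman_weight \<alpha> m) < \<epsilon>"
    proof (rule SF_approximates_polynomial[OF N \<alpha> _ \<epsilon>])
      show "\<forall>m\<ge>M. d m = 0" by (simp add: d_def)
    qed (rule that)
    define g where "g = restrict (\<lambda>z. \<Sum>k<n. 1 / (z - a k) ^ N) (ball 0 1)"
    have gs: "disc_series (SF_coeff N n a) g"
      using SF_sums[of n a N] a N by (simp add: g_def disc_series_def)
    have gSF: "g \<in> SF N" using a unfolding SF_def g_def by auto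
    have gA: "g \<in> bergman_space \<alpha>"
      using bergman_space_iff_summable[OF \<alpha>1 _ gs] sg by (simp add: g_def)
    define X where "X m = (cmod (c m - d m))\<^sup>2 * bergman_weight \<alpha> m" for m
    define Y where "Y m = (cmod (d m - SF_coeff N n a m))\<^sup>2 * bergman_weight \<alpha> m" for m
    define Z where "Z m = (cmod (c m - SF_coeff N n a m))\<^sup>2 * bergman_weight \<alpha> m" for m
    have sX: "summable X"
      unfolding X_def using w0 by (intro summable_comparison_test'[OF sc, of 0]) (auto simp: d_def)
    have sY: "summable Y" using sh by (simp add: Y_def[abs_def])
    have "(\<Sum>m. X m) = (\<Sum>m. X (m + M)) + (\<Sum>m<M. X m)"
      by (rule suminf_split_initial_segment[OF sX])
    also have "\<dots> = (\<Sum>m. (cmod (c (m + M)))\<^sup>2 * bergman_weight \<alpha> (m + M))"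
      by (simp add: X_def d_def)
    finally have X: "(\<Sum>m. X m) < \<epsilon>" using M by simp
    have ZXY: "Z m \<le> 2 * X m + 2 * Y m" for m
    proof -
      have "(cmod ((c m - d m) - (SF_coeff N n a m - d m)))\<^sup>2
          \<le> 2 * (cmod (c m - d m))\<^sup>2 + 2 * (cmod (d m - SF_coeff N n a m))\<^sup>2"
        using cmod_diff_square_le[of "c m - d m" "SF_coeff N n a m - d m"] by (simp add: norm_minus_commute)
      then have "Z m \<le> (2 * (cmod (c m - d m))\<^sup>2 + 2 * (cmod (d m - SF_coeff N n a m))\<^sup>2) * bergman_weight \<alpha> m"
        unfolding Z_def using w0 by (intro mult_right_mono) auto
      then show ?thesis by (simp add: X_def Y_def algebra_simps)
    qed
    have sXY: "summable (\<lambda>m. 2 * X m + 2 * Y m)"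
      by (intro summable_add summable_mult sX sY)
    have sZ: "summable Z"
      using w0 ZXY by (intro summable_comparison_test'[OF sXY, of 0]) (simp add: Z_def)
    have "(\<Sum>m. Z m) \<le> (\<Sum>m. 2 * X m + 2 * Y m)"
      by (intro suminf_le ZXY sZ sXY)
    also have "\<dots> = 2 * (\<Sum>m. X m) + 2 * (\<Sum>m. Y m)"
      using sX sY by (simp add: suminf_add[symmetric] suminf_mult summable_mult)
    also have "\<dots> < 4 * \<epsilon>" using X h by (simp add: Y_def)
    finally have "(\<alpha> + 1) * (\<Sum>m. Z m) < r\<^sup>2"
      using \<alpha>1 by (simp add: \<epsilon>_def field_simps)
    then have "sqrt ((\<alpha> + 1) * (\<Sum>m. Z m)) < r"
      using r by (intro real_less_lsqrt) auto
    then have "bergman_dist \<alpha> f g < r"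
      using bergman_dist_eq_suminf[OF \<alpha>1 c gs] sZ by (simp add: Z_def[abs_def])
    then show ?thesis using gSF gA by blast
  qed
  then show ?thesis by (auto simp: bergman_closure_iff[OF \<alpha>1])
qed

theorem theorem1p7:
  fixes N :: nat and \<alpha>\<^sub>0 :: real
  assumes "N \<ge> 2" and "\<alpha>\<^sub>0 = 2 * (real N - 1) + 1"
  shows
    "(\<forall>\<alpha>::real. 2 * (real N - 1) < \<alpha> \<and> \<alpha> < \<alpha>\<^sub>0 \<longrightarrow>
        bergman_topology \<alpha> interior_of (bergman_topology \<alpha> closure_of SF N) = {}) \<and>
     bergman_topology \<alpha>\<^sub>0 closure_of SF N \<noteq> bergman_space \<alpha>\<^sub>0 \<and>
     (\<forall>\<alpha>::real. \<alpha> > \<alpha>\<^sub>0 + 1 \<longrightarrow>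
        bergman_topology \<alpha> closure_of SF N = bergman_space \<alpha>)"
  \<comment> \<open>Here \<open>\<alpha>\<^sub>0 = 2 * N - 1\<close>, which turns the three ranges
    of \<open>\<alpha>\<close> into the hypotheses of the three lemmas.\<close>
  using assms
  by (intro conjI allI impI SF_closure_interior_empty SF_not_dense SF_dense) (auto simp: algebra_simps)

end
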